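(* Let $\gamma\in(0,1)$, $0<\lambda\le\Lambda$, $m\ge1$. Let $\varepsilon>0$ and let $$\mathcal{N}_\varepsilon\subset\{(x',x'')\in\mathbb{R}^m\times\mathbb{R}^m:\ |x''|<|x'|<|x''|+\varepsilon\}\subset\mathcal{O}$$ be an open set (not necessarily bounded). Let $K$ be a radially symmetric kernel on $\mathbb{R}^{2m}\setminus\{0\}$ satisfying the positivity condition $$\overline K(x,y)-\overline K(x,y^\star)>0\quad\text{for every }x,y\in\mathcal{O},$$ and such that $L_K\in\mathcal{L}_0(2m,\gamma,\lambda,\Lambda)$. Let $v\in C(\overline{\mathcal{N}_\varepsilon})\cap C^\alpha(\mathcal{N}_\varepsilon)\cap L^1_\gamma(\mathbb{R}^{2m})$, for some $\alpha>2\gamma$, be a doubly radial function satisfying $$\begin{cases}L_Kv+c(x)v\le0&\text{in }\mathcal{N}_\varepsilon,\\ v\le0&\text{in }\mathcal{O}\setminus\mathcal{N}_\varepsilon,\\ -v(x^\star)=v(x)&\text{in }\mathbb{R}^{2m},\\ \displaystyle\limsup_{x\in\mathcal{N}_\varepsilon,\,|x|\to\infty}v(x)\le0,\end{cases}$$ with $c$ a function bounded from below. Under these assumptions there exists $\overline\varepsilon>0$, depending only on $\lambda$, $m$, $\gamma$ and $\|c_-\|_{L^\infty}$, such that, if $\varepsilon<\overline\varepsilon$, then $v\le0$ in $\mathcal{N}_\varepsilon$.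
   Context: For a kernel $K$ on $\mathbb{R}^n\setminus\{0\}$, $L_K w(x)=\int_{\mathbb{R}^n}(w(x)-w(y))K(x-y)\,dy$ (principal value sense). For $\gamma\in(0,1)$ and $0<\lambda\le\Lambda$, $L_K\in\mathcal{L}_0(n,\gamma,\lambda,\Lambda)$ means $K(z)=K(-z)$ and $\lambda c_{n,\gamma}|z|^{-n-2\gamma}\le K(z)\le\Lambda c_{n,\gamma}|z|^{-n-2\gamma}$, where $c_{n,\gamma}=\gamma\,\frac{2^{2\gamma}\Gamma(\frac n2+\gamma)}{\pi^{n/2}\Gamma(1-\gamma)}$. If $K$ is radially symmetric, we write $K(z)=K(|z|)$. $L^1_\gamma(\mathbb{R}^n)$ is the space of measurable functions $w$ with $\int_{\mathbb{R}^n}\frac{|w(x)|}{1+|x|^{n+2\gamma}}\,dx<+\infty$. $c_-$ is the negative part of $c$. Write $x=(x',x'')\in\mathbb{R}^m\times\mathbb{R}^m=\mathbb{R}^{2m}$, $\mathcal{O}=\{|x'|>|x''|\}$, $x^\star=(x'',x')$. A function on $\mathbb{R}^{2m}$ is doubly radial if it depends only on $|x'|$ and $|x''|$. For radially symmetric $K$, $\overline K(x,y)=\int_{O(m)^2}K(|Rx-y|)\,dR$, where $dR$ is the normalized (probability) Haar measure on $O(m)^2=O(m)\times O(m)$, whose elements act on $\mathbb{R}^m\times\mathbb{R}^m$ componentwise, and $O(m)$ is the orthogonal group of $\mathbb{R}^m$. *)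

theory Defs
  imports "HOL-Probability.Probability"
begin

section \<open>Integro-differential operators\<close>

definition c_const :: "nat \<Rightarrow> real \<Rightarrow> real" where
  "c_const n \<gamma> =
     \<gamma> * (2 powr (2 * \<gamma>) * Gamma (real n / 2 + \<gamma>)) / (pi powr (real n / 2) * Gamma (1 - \<gamma>))"

text \<open>
  A kernel on the punctured space is a total function whose value at the origin is never used.
  Measurability of the kernel is part of the definition.
\<close>

definition kernel_class_L0 ::
    "real \<Rightarrow> real \<Rightarrow> real \<Rightarrow> ('a::euclidean_space \<Rightarrow> real) \<Rightarrow> bool" where
  "kernel_class_L0 \<gamma> lam Lam K \<longleftrightarrow>
     K \<in> borel_measurable lebesgue \<and>
     (\<forall>z. z \<noteq> 0 \<longrightarrow>
        K z = K (- z) \<and>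
        lam * c_const DIM('a) \<gamma> * norm z powr (- real DIM('a) - 2 * \<gamma>) \<le> K z \<and>
        K z \<le> Lam * c_const DIM('a) \<gamma> * norm z powr (- real DIM('a) - 2 * \<gamma>))"

definition radially_symmetric :: "('a::euclidean_space \<Rightarrow> real) \<Rightarrow> bool" where
  "radially_symmetric K \<longleftrightarrow> (\<forall>z w. z \<noteq> 0 \<longrightarrow> norm z = norm w \<longrightarrow> K z = K w)"

definition L_op :: "('a::euclidean_space \<Rightarrow> real) \<Rightarrow> ('a \<Rightarrow> real) \<Rightarrow> 'a \<Rightarrow> real" where
  "L_op K w x =
     Lim (at_right 0) (\<lambda>r. LINT y : {y. r < norm (x - y)} | lebesgue. (w x - w y) * K (x - y))"

definition L1_weighted :: "real \<Rightarrow> ('a::euclidean_space \<Rightarrow> real) set" where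
  "L1_weighted \<gamma> =
     {w. w \<in> borel_measurable lebesgue \<and>
         integrable lebesgue (\<lambda>x. \<bar>w x\<bar> / (1 + norm x powr (real DIM('a) + 2 * \<gamma>)))}"

text \<open>
  The space \<open>C\<^sup>\<alpha>(S)\<close> on an open set \<open>S\<close>, for any real \<open>\<alpha> > 0\<close>, is \<open>C\<^bsup>k,\<beta>\<^esup>(S)\<close> with \<open>k\<close> and \<open>\<beta>\<close>
  the integer and fractional parts of \<open>\<alpha>\<close>; Hoelder conditions are local in \<open>S\<close>, with no
  uniformity up to the boundary. For \<open>\<beta> = 0\<close> the Hoelder condition is local boundedness, so that
  \<open>C\<^bsup>k,0\<^esup> = C\<^sup>k\<close>.
\<close>

primrec Ck_Holder :: "nat \<Rightarrow> real \<Rightarrow> 'a::euclidean_space set \<Rightarrow> ('a \<Rightarrow> real) \<Rightarrow> bool" where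
  "Ck_Holder 0 \<beta> S f \<longleftrightarrow>
     continuous_on S f \<and>
     (\<forall>x\<in>S. \<exists>r>0. \<exists>C. \<forall>y\<in>ball x r \<inter> S. \<forall>z\<in>ball x r \<inter> S. \<bar>f y - f z\<bar> \<le> C * dist y z powr \<beta>)"
| "Ck_Holder (Suc k) \<beta> S f \<longleftrightarrow>
     f differentiable_on S \<and>
     (\<forall>b\<in>Basis. Ck_Holder k \<beta> S (\<lambda>x. frechet_derivative f (at x) b))"

definition Holder_space :: "real \<Rightarrow> 'a::euclidean_space set \<Rightarrow> ('a \<Rightarrow> real) set" where
  "Holder_space \<alpha> S = {f. Ck_Holder (nat \<lfloor>\<alpha>\<rfloor>) (frac \<alpha>) S f}"

text \<open>The norm of \<open>L\<^sup>\<infinity>(S)\<close>, i.e. the essential supremum of \<open>\<bar>f\<bar>\<close> over \<open>S\<close>;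
  unlike \<^const>\<open>esssup\<close>, it is also meaningful if \<open>f\<close> is not measurable.\<close>

definition Linf_norm :: "'a::euclidean_space set \<Rightarrow> ('a \<Rightarrow> real) \<Rightarrow> real" where
  "Linf_norm S f = Inf {B. 0 \<le> B \<and> (AE x in lebesgue. x \<in> S \<longrightarrow> \<bar>f x\<bar> \<le> B)}"


section \<open>Doubly radial functions\<close>

text \<open>
  \<open>\<real>\<^bsup>2m\<^esup> = \<real>\<^sup>m \<times> \<real>\<^sup>m\<close> is the product type below, with \<open>m = CARD('m)\<close>; the norm of a product type is
  the Euclidean one.
\<close>

type_synonym 'm dbl = "(real^'m) \<times> (real^'m)"

definition cone_O :: "('m::finite) dbl set" where
  "cone_O = {x. norm (fst x) > norm (snd x)}"

definition star :: "('m::finite) dbl \<Rightarrow> 'm dbl" where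
  "star x = (snd x, fst x)"

definition doubly_radial :: "(('m::finite) dbl \<Rightarrow> real) \<Rightarrow> bool" where
  "doubly_radial w \<longleftrightarrow>
     (\<forall>x y. norm (fst x) = norm (fst y) \<longrightarrow> norm (snd x) = norm (snd y) \<longrightarrow> w x = w y)"


section \<open>The averaged kernel\<close>

type_synonym 'm mat2 = "(real^'m^'m) \<times> (real^'m^'m)"

definition O2 :: "('m::finite) mat2 set" where
  "O2 = {R. orthogonal_matrix (fst R) \<and> orthogonal_matrix (snd R)}"

definition mult2 :: "('m::finite) mat2 \<Rightarrow> 'm mat2 \<Rightarrow> 'm mat2" where
  "mult2 Q R = (fst Q ** fst R, snd Q ** snd R)"

definition act2 :: "('m::finite) mat2 \<Rightarrow> 'm dbl \<Rightarrow> 'm dbl" where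
  "act2 R x = (fst R *v fst x, snd R *v snd x)"

text \<open>
  The normalized Haar measure of the compact group \<open>O(m)\<^sup>2\<close> is its only left-invariant Borel
  probability measure.
\<close>

definition normalized_Haar_O2 :: "('m::finite) mat2 measure \<Rightarrow> bool" where
  "normalized_Haar_O2 \<mu> \<longleftrightarrow>
     prob_space \<mu> \<and>
     space \<mu> = O2 \<and>
     sets \<mu> = sets (restrict_space borel O2) \<and>
     (\<forall>Q\<in>O2. distr \<mu> \<mu> (mult2 Q) = \<mu>)"

text \<open>
  \<open>Kbar \<mu> K x y\<close> is infinite when \<open>y\<close> lies on the orbit of \<open>x\<close>, as the kernel is too singular to be
  integrable there; hence the values in \<^typ>\<open>ennreal\<close>. For \<open>m = 1\<close> the group is finite and on
  such orbits the integrand is evaluated at the origin with positive probability, so the kernel is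
  extended to the origin by its limit \<open>\<infinity>\<close>.
\<close>

definition Kbar ::
    "('m::finite) mat2 measure \<Rightarrow> ('m dbl \<Rightarrow> real) \<Rightarrow> 'm dbl \<Rightarrow> 'm dbl \<Rightarrow> ennreal" where
  "Kbar \<mu> K x y =
     (\<integral>\<^sup>+ R. (if act2 R x - y = 0 then \<infinity> else ennreal (K (act2 R x - y))) \<partial>\<mu>)"

text \<open>
  The condition \<open>Kbar x y - Kbar x (star y) > 0\<close>. It is written as an inequality between extended
  numbers; for \<open>x\<close>, \<open>y\<close> in the cone the right-hand term \<open>Kbar x (star y)\<close> of the difference is finite,
  as \<open>star y\<close> is not on the orbit of \<open>x\<close>.
\<close>

definition positivity_condition ::
    "('m::finite) mat2 measure \<Rightarrow> ('m dbl \<Rightarrow> real) \<Rightarrow> bool" where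
  "positivity_condition \<mu> K \<longleftrightarrow>
     (\<forall>x\<in>cone_O. \<forall>y\<in>cone_O. Kbar \<mu> K x (star y) < Kbar \<mu> K x y)"

end

theory Submission
  imports Defs
begin

text \<open>
  Suppose that \<open>v\<close> is positive somewhere in \<open>N\<close>. Then \<open>v\<close> has a positive maximum \<open>M\<close> over the cone,
  attained at some \<open>x0 \<in> N\<close>. Folding the reflected cone onto the cone, \<open>L v (x0)\<close> becomes the
  integral over the cone of \<open>M - v\<close> against \<open>Kbar x0 y - Kbar x0 (star y)\<close>, which is nonnegative, plus
  \<open>2 M\<close> times the integral of \<open>K (x0 - y)\<close> over the reflected cone. As \<open>x0\<close> is within \<open>\<epsilon>\<close> of the
  reflected cone, the latter integral is at least a constant times \<open>\<epsilon> powr (- 2 \<gamma>)\<close>, which for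
  small \<open>\<epsilon>\<close> contradicts \<open>L v (x0) \<le> - c x0 * M\<close>.
\<close>

text \<open>The principal value removes balls, whereas folding needs sets invariant under O(m)^2,
  and \<open>Kbar\<close> is infinite on the orbit of the centre. Hence the kernels are compared
  only off a tube around that orbit.

  The equation is evaluated at a point x merely close to x0, so x need not be a maximum. This costs
  two errors: \<open>M - v x\<close> times the mass of \<open>K\<close> outside a ball of radius
  \<rho>, and the part of the integral inside that ball, which has no sign and is bounded through
  second differences. The radius \<rho> is fixed first, making the inner error small; x is chosen
  afterwards, depending on \<rho>.

  \<open>Lam\<close> serves for integrability and enters the inner error, which \<rho> absorbs, so
  the threshold for \<epsilon> does not depend on it. The factor 2 in 2 M J, with J the integral
  over the reflected cone, pays for all errors: it suffices that J is at least the bound for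
  -c.\<close>

section \<open>Isometries and Lebesgue measure\<close>

text \<open>The measure of a ball depends only on its radius, and an isometry pulls balls back to
  balls of the same radius. By Vitali's theorem an open set is, up to a negligible set, a countable
  disjoint union of balls, and Lipschitz maps preserve negligibility. The metric form of the
  hypothesis covers point reflections, translations, \<open>star\<close> and \<open>act2 R\<close>
  at once.\<close>

lemma distr_lborel_isometry:
  fixes T :: "'a::euclidean_space \<Rightarrow> 'a"
  assumes iso: "\<And>x y. dist (T x) (T y) = dist x y" and "surj T"
  shows "distr lborel lborel T = lborel"
proof -
  have "inj T"
    by (rule injI) (metis iso dist_eq_0_iff)
  then have bij: "bij T"
    using \<open>surj T\<close> by (simp add: bij_def)
  define T' where "T' = inv T"
  have TT': "T (T' x) = x" and T'T: "T' (T x) = x" for x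
    using bij by (simp_all add: T'_def bij_inv_eq_iff surj_f_inv_f[OF \<open>surj T\<close>] inv_f_f[OF \<open>inj T\<close>])
  have iso': "dist (T' x) (T' y) = dist x y" for x y
    by (metis TT' iso)
  have vball: "T -` ball c r = ball (T' c) r" for c r
  proof (rule set_eqI)
    show "x \<in> T -` ball c r \<longleftrightarrow> x \<in> ball (T' c) r" for x
      using iso[of "T' c" x] by (simp add: TT')
  qed
  have "continuous_on UNIV T"
    by (rule lipschitz_on_continuous_on[of 1]) (simp add: lipschitz_on_def iso)
  then have T_meas[measurable]: "T \<in> borel_measurable borel"
    by (rule borel_measurable_continuous_onI)
  have eq: "emeasure (distr lborel lborel T) U = emeasure lborel U" if U: "open U" for U
  proof -
    define I where "I = {p :: 'a \<times> real. 0 < snd p \<and> ball (fst p) (snd p) \<subseteq> U}"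
    have cover: "\<exists>i. i \<in> I \<and> x \<in> ball (fst i) (snd i) \<and> snd i < d" if "x \<in> U" "0 < d" for x d
    proof -
      obtain e where "e > 0" "ball x e \<subseteq> U"
        using U \<open>x \<in> U\<close> openE by blast
      then have "(x, min e (d/2)) \<in> I"
        using \<open>0 < d\<close> by (auto simp: I_def)
      moreover have "x \<in> ball x (min e (d/2)) \<and> min e (d/2) < d"
        using \<open>0 < d\<close> \<open>0 < e\<close> by auto
      ultimately show ?thesis by (intro exI[of _ "(x, min e (d/2))"]) auto
    qed
    obtain C where C: "countable C" "C \<subseteq> I"
      and disj: "pairwise (\<lambda>i j. disjnt (ball (fst i) (snd i)) (ball (fst j) (snd j))) C"
      and neg: "negligible (U - (\<Union>i\<in>C. ball (fst i) (snd i)))"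
      by (rule Vitali_covering_theorem_balls[OF cover]) 
    let ?B = "\<Union>i\<in>C. ball (fst i) (snd i)"
    have sub: "?B \<subseteq> U" using C by (auto simp: I_def)
    have df: "disjoint_family_on (\<lambda>i. ball (fst i) (snd i)) C"
      using disj by (simp add: disjoint_family_on_def pairwise_def disjnt_def)
    have neg': "negligible (T' ` (U - ?B))"
    proof (rule negligible_locally_Lipschitz_image[OF _ neg])
      show "\<exists>S B. open S \<and> x \<in> S \<and> (\<forall>y\<in>(U - ?B) \<inter> S. norm (T' y - T' x) \<le> B * norm (y - x))" for x
        by (intro exI[of _ UNIV] exI[of _ 1]) (auto simp: iso' simp flip: dist_norm)
    qed auto
    have null: "A \<in> sets borel \<Longrightarrow> negligible A \<Longrightarrow> A \<in> null_sets lborel" for A :: "'a set"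
      by (simp add: negligible_iff_null_sets null_sets_completion_iff)
    have "T -` (U - ?B) = T' ` (U - ?B)"
    proof (rule set_eqI)
      show "x \<in> T -` (U - ?B) \<longleftrightarrow> x \<in> T' ` (U - ?B)" for x
      proof
        assume "x \<in> T -` (U - ?B)"
        then have "T' (T x) \<in> T' ` (U - ?B)" by (intro imageI) simp
        then show "x \<in> T' ` (U - ?B)" by (simp only: T'T)
      next
        assume "x \<in> T' ` (U - ?B)"
        then obtain y where "x = T' y" "y \<in> U - ?B" by (rule imageE)
        then show "x \<in> T -` (U - ?B)" by (simp only: vimage_eq TT')
      qed
    qed
    moreover have "T -` (U - ?B) \<in> sets borel"
      using measurable_sets[OF T_meas, of "U - ?B"] U by (simp add: borel_open open_UN)
    ultimately have null1: "T -` (U - ?B) \<in> null_sets lborel"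
      using neg' null by simp
    have null2: "U - ?B \<in> null_sets lborel"
      using neg null U by (simp add: borel_open open_UN)
    have "emeasure (distr lborel lborel T) U = emeasure lborel (T -` U)"
      using U by (subst emeasure_distr) auto
    also have "T -` U = (\<Union>i\<in>C. ball (T' (fst i)) (snd i)) \<union> T -` (U - ?B)"
      unfolding vball[symmetric] using sub by blast
    also have "emeasure lborel \<dots> = emeasure lborel (\<Union>i\<in>C. ball (T' (fst i)) (snd i))"
      by (intro emeasure_Un_null_set null1) (auto intro: borel_open open_UN)
    also have "\<dots> = (\<integral>\<^sup>+i. emeasure lborel (ball (T' (fst i)) (snd i)) \<partial>count_space C)"
    proof (rule emeasure_UN_countable)
      have "disjoint_family_on (\<lambda>i. T -` ball (fst i) (snd i)) C"
        using df by (simp add: disjoint_family_on_def flip: vimage_Int)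
      then show "disjoint_family_on (\<lambda>i. ball (T' (fst i)) (snd i)) C"
        by (simp add: vball)
    qed (use C in auto)
    also have "\<dots> = (\<integral>\<^sup>+i. emeasure lborel (ball (fst i) (snd i)) \<partial>count_space C)"
    proof (rule nn_integral_cong)
      fix i assume "i \<in> space (count_space C)"
      then have "0 < snd i" using C by (auto simp: I_def)
      then show "emeasure lborel (ball (T' (fst i)) (snd i)) = emeasure lborel (ball (fst i) (snd i))"
        by (simp add: emeasure_ball)
    qed
    also have "\<dots> = emeasure lborel ?B"
      by (rule emeasure_UN_countable[symmetric]) (use C df in auto)
    also have "\<dots> = emeasure lborel (?B \<union> (U - ?B))"
      by (rule emeasure_Un_null_set[symmetric]) (auto intro!: null2 borel_open open_UN)
    also have "?B \<union> (U - ?B) = U" using sub by blast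
    finally show ?thesis .
  qed
  show ?thesis
  proof (rule measure_eqI_generator_eq[where E="{S. open S}" and \<Omega>=UNIV and A="\<lambda>n. ball 0 (real n)"])
    show "Int_stable {S :: 'a set. open S}"
      by (auto simp: Int_stable_def)
    show "sets (distr lborel lborel T) = sigma_sets UNIV {S :: 'a set. open S}"
      by (simp add: borel_def)
    show "sets lborel = sigma_sets UNIV {S :: 'a set. open S}"
      by (simp add: borel_def)
    show "(\<Union>i. ball 0 (real i)) = (UNIV :: 'a set)"
      by (auto intro: reals_Archimedean2)
    show "emeasure (distr lborel lborel T) (ball 0 (real i)) \<noteq> \<infinity>" for i
      by (subst eq) (auto simp: emeasure_ball)
  qed (auto intro: eq)
qed

lemma
  fixes T :: "'a::euclidean_space \<Rightarrow> 'a"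
  assumes iso: "\<And>x y. dist (T x) (T y) = dist x y" and "surj T"
  shows measurable_lebesgue_isometry: "T \<in> lebesgue \<rightarrow>\<^sub>M lebesgue"
    and distr_lebesgue_isometry: "distr lebesgue lebesgue T = lebesgue"
proof -
  have "continuous_on UNIV T"
    by (rule lipschitz_on_continuous_on[of 1]) (simp add: lipschitz_on_def iso)
  then have T: "T \<in> lborel \<rightarrow>\<^sub>M lborel"
    by (simp add: borel_measurable_continuous_onI)
  have T': "T \<in> lebesgue \<rightarrow>\<^sub>M lborel"
    by (rule measurable_completion[OF T])
  have d: "distr lebesgue lborel T = lborel"
    by (simp add: distr_completion[OF T] distr_lborel_isometry[OF assms])
  show "T \<in> lebesgue \<rightarrow>\<^sub>M lebesgue"
    by (rule completion.measurable_completion2[OF T']) (simp add: d)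
  show "distr lebesgue lebesgue T = lebesgue"
    using completion.completion_distr_eq[OF T'] by (simp add: d)
qed

lemma nn_integral_lebesgue_isometry:
  fixes T :: "'a::euclidean_space \<Rightarrow> 'a"
  assumes "\<And>x y. dist (T x) (T y) = dist x y" and "surj T" and "f \<in> borel_measurable lebesgue"
  shows "(\<integral>\<^sup>+x. f (T x) \<partial>lebesgue) = (\<integral>\<^sup>+x. f x \<partial>lebesgue)"
  using nn_integral_distr[OF measurable_lebesgue_isometry[OF assms(1,2)], of f] assms(3)
  by (simp add: distr_lebesgue_isometry[OF assms(1,2)])

lemma integral_lebesgue_isometry:
  fixes T :: "'a::euclidean_space \<Rightarrow> 'a" and f :: "'a \<Rightarrow> real"
  assumes "\<And>x y. dist (T x) (T y) = dist x y" and "surj T" and "f \<in> borel_measurable lebesgue"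
  shows "(LINT x|lebesgue. f (T x)) = (LINT x|lebesgue. f x)"
  using integral_distr[OF measurable_lebesgue_isometry[OF assms(1,2)], of f] assms(3)
  by (simp add: distr_lebesgue_isometry[OF assms(1,2)])

lemma integrable_lebesgue_isometry:
  fixes T :: "'a::euclidean_space \<Rightarrow> 'a" and f :: "'a \<Rightarrow> real"
  assumes "\<And>x y. dist (T x) (T y) = dist x y" and "surj T" and "integrable lebesgue f"
  shows "integrable lebesgue (\<lambda>x. f (T x))"
  using integrable_distr[OF measurable_lebesgue_isometry[OF assms(1,2)], of f] assms(3)
  by (simp add: distr_lebesgue_isometry[OF assms(1,2)])

section \<open>Point reflections, translations and the swap of the two factors\<close>

lemma
  fixes x :: "'a::real_normed_vector"
  shows dist_reflect: "dist (x - y) (x - z) = dist y z"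
    and surj_reflect: "surj (\<lambda>y. x - y)"
  by (simp_all add: dist_norm norm_minus_commute surjI[of _ "\<lambda>y. x - y"])

lemma
  fixes x :: "'a::real_normed_vector"
  shows dist_translate: "dist (x + y) (x + z) = dist y z"
    and surj_translate: "surj (\<lambda>y. x + y)"
  by simp_all

lemma
  fixes y z :: "('m::finite) dbl"
  shows dist_star: "dist (star y) (star z) = dist y z"
    and surj_star: "surj (star :: 'm dbl \<Rightarrow> 'm dbl)"
    and star_star: "star (star y) = y"
proof -
  show "dist (star y) (star z) = dist y z"
    by (simp add: star_def dist_prod_def add.commute)
  have s: "star (star y) = y" for y :: "'m dbl" by (simp add: star_def)
  then show "star (star y) = y" .
  show "surj (star :: 'm dbl \<Rightarrow> _)" by (rule surjI[of _ star]) (rule s)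
qed

text \<open>Needed to exchange the Lebesgue integral with the integral over the group.\<close>

lemma sigma_finite_lebesgue: "sigma_finite_measure (lebesgue :: 'a::euclidean_space measure)"
proof
  obtain A :: "'a set set" where A: "countable A" "A \<subseteq> sets lborel" "\<Union>A = space lborel"
      "\<forall>a\<in>A. emeasure lborel a \<noteq> \<infinity>"
    using lborel.sigma_finite_countable by blast
  have "emeasure lebesgue a \<noteq> \<infinity>" "a \<in> sets lebesgue" if "a \<in> A" for a
    using A(2,4) that by (auto simp: subset_eq)
  then show "\<exists>A. countable A \<and> A \<subseteq> sets lebesgue \<and> \<Union>A = space (lebesgue :: 'a measure)
      \<and> (\<forall>a\<in>A. emeasure lebesgue a \<noteq> \<infinity>)"
    using A(1,3) by (intro exI[of _ A]) auto
qed

section \<open>Integrals of powers of the norm\<close>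

lemma term_le_suminf_ennreal: "f k \<le> (\<Sum>k. f k)" for f :: "nat \<Rightarrow> ennreal"
  using sum_le_suminf[of f "{k}"] by simp

lemma powr_power_mult:
  fixes x y r :: real
  assumes "0 < x" "0 < y"
  shows "(x ^ k * y) powr r = (x powr r) ^ k * y powr r"
  using assms by (induction k) (simp_all add: powr_mult mult.assoc)

lemma powr_minus_mult_power:
  fixes w r :: real
  assumes "0 < w"
  shows "w powr - r * w ^ n = w powr (real n - r)"
  using assms by (simp add: powr_realpow[symmetric] powr_add[symmetric])

text \<open>Dyadic shells replace polar coordinates. On the k-th shell the integrand is at most
  \<open>(2 ^ k * \<rho>) powr - p\<close>, and the shell lies in a ball of radius
  \<open>2 ^ Suc k * \<rho>\<close>; this gives a geometric series of ratio
  \<open>2 powr (n - p)\<close>, which is below 1.\<close>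

lemma nn_integral_norm_powr_outside_ball:
  fixes p \<rho> :: real
  assumes p: "real DIM('a::euclidean_space) < p" and \<rho>: "0 < \<rho>"
  shows "(\<integral>\<^sup>+(z::'a). ennreal (norm z powr - p) * indicator {z. \<rho> < norm z} z \<partial>lborel) < \<infinity>"
proof -
  define n where "n = DIM('a)"
  define V where "V = unit_ball_vol (real n)"
  have V: "0 \<le> V" by (simp add: V_def)
  define q where "q = 2 powr (real n - p)"
  define A where "A = V * 2 ^ n * \<rho> powr (real n - p)"
  have q: "0 \<le> q" "q < 1"
    using p powr_less_mono[of "real n - p" 0 2] by (auto simp: q_def n_def)
  have A: "0 \<le> A" using V by (simp add: A_def)
  let ?f = "\<lambda>k (z::'a). ennreal ((2 ^ k * \<rho>) powr - p) * indicator (cball 0 (2 ^ Suc k * \<rho>)) z"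
  have le: "ennreal (norm z powr - p) * indicator {z. \<rho> < norm z} z \<le> (\<Sum>k. ?f k z)" for z :: 'a
  proof (cases "\<rho> < norm z")
    case True
    obtain j where "norm z / \<rho> < 2 ^ j"
      using real_arch_pow[of 2 "norm z / \<rho>"] by auto
    then have "norm z < 2 ^ j * \<rho>"
      using \<rho> by (simp add: pos_divide_less_eq)
    also have "\<dots> \<le> 2 ^ Suc j * \<rho>"
      using \<rho> by (intro mult_right_mono) auto
    finally have "norm z \<le> 2 ^ Suc j * \<rho>"
      by simp
    then have ex: "\<exists>k. norm z \<le> 2 ^ Suc k * \<rho>" by blast
    \<comment> \<open>The least such index selects the shell containing \<open>z\<close>; minimality
      gives the lower bound on \<open>norm z\<close>.\<close>
    define k where "k = (LEAST k. norm z \<le> 2 ^ Suc k * \<rho>)"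
    have up: "norm z \<le> 2 ^ Suc k * \<rho>"
      unfolding k_def by (rule LeastI_ex[OF ex])
    have low: "2 ^ k * \<rho> \<le> norm z"
    proof (cases k)
      case 0 then show ?thesis using True by simp
    next
      case (Suc i)
      then have "\<not> norm z \<le> 2 ^ Suc i * \<rho>"
        using not_less_Least[of i "\<lambda>k. norm z \<le> 2 ^ Suc k * \<rho>"] by (simp add: k_def)
      then show ?thesis using Suc by simp
    qed
    have "norm z powr - p \<le> (2 ^ k * \<rho>) powr - p"
      using low \<rho> p by (intro powr_mono2') auto
    then have "ennreal (norm z powr - p) * indicator {z. \<rho> < norm z} z \<le> ?f k z"
      using True up by (simp add: ennreal_leI)
    also have "\<dots> \<le> (\<Sum>k. ?f k z)"
      by (rule term_le_suminf_ennreal)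
    finally show ?thesis .
  qed auto
  have "(\<integral>\<^sup>+(z::'a). ennreal (norm z powr - p) * indicator {z. \<rho> < norm z} z \<partial>lborel)
      \<le> (\<integral>\<^sup>+z. (\<Sum>k. ?f k z) \<partial>lborel)"
    by (intro nn_integral_mono le)
  also have "\<dots> = (\<Sum>k. \<integral>\<^sup>+z. ?f k z \<partial>lborel)"
    by (intro nn_integral_suminf borel_measurable_times_ennreal borel_measurable_const
        borel_measurable_indicator) simp
  also have "\<dots> = (\<Sum>k. ennreal (A * q ^ k))"
  proof (intro suminf_cong)
    fix k
    have "(\<integral>\<^sup>+z. ?f k z \<partial>lborel) = ennreal ((2 ^ k * \<rho>) powr - p * (V * (2 ^ Suc k * \<rho>) ^ n))"
      using \<rho> V
      by (subst nn_integral_cmult_indicator)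
         (auto simp: emeasure_cball V_def n_def ennreal_mult)
    also have "(2 ^ k * \<rho>) powr - p * (V * (2 ^ Suc k * \<rho>) ^ n) = A * q ^ k"
    proof -
      define w where "w = 2 ^ k * \<rho>"
      have w: "w > 0" using \<rho> by (simp add: w_def)
      have "(2 ^ k * \<rho>) powr - p * (V * (2 ^ Suc k * \<rho>) ^ n) = w powr - p * (V * (2 * w) ^ n)"
        by (simp only: w_def power_Suc mult.assoc)
      also have "\<dots> = V * 2 ^ n * (w powr - p * w ^ n)"
        by (simp add: power_mult_distrib)
      also have "\<dots> = A * q ^ k"
        unfolding powr_minus_mult_power[OF w] unfolding w_def A_def q_def
        using \<rho> by (subst powr_power_mult) simp_all
      finally show ?thesis .
    qed
    finally show "(\<integral>\<^sup>+z. ?f k z \<partial>lborel) = ennreal (A * q ^ k)" .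
  qed
  also have "\<dots> < \<infinity>"
    using A q by (subst suminf_ennreal2) (auto intro!: summable_mult summable_geometric)
  finally show ?thesis .
qed

text \<open>The same argument with shells shrinking to the origin, now with ratio
  \<open>(1/2) powr (n - q)\<close>. The constant \<open>B\<close> is chosen before \<rho>, so the
  bound shows how fast the integral vanishes as \<rho> tends to 0.\<close>

lemma nn_integral_norm_powr_cball:
  fixes q :: real
  assumes q: "0 \<le> q" "q < real DIM('a::euclidean_space)"
  obtains B where "0 \<le> B" and "\<And>\<rho>. 0 < \<rho> \<Longrightarrow>
    (\<integral>\<^sup>+(z::'a). ennreal (norm z powr - q) * indicator (cball 0 \<rho>) z \<partial>lborel)
      \<le> ennreal (B * \<rho> powr (real DIM('a) - q))"
proof -
  define n where "n = DIM('a)"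
  define V where "V = unit_ball_vol (real n)"
  have V: "0 \<le> V" by (simp add: V_def)
  define a where "a = (1/2) powr (real n - q)"
  have a: "0 \<le> a" "a < 1"
    using q powr_less_mono'[of "1/2" 0 "real n - q"] by (auto simp: a_def n_def)
  define B where "B = V * 2 powr q * (\<Sum>k. a ^ k)"
  have "0 \<le> B" unfolding B_def using V a by (intro mult_nonneg_nonneg suminf_nonneg) (auto intro!: summable_geometric)
  moreover have "(\<integral>\<^sup>+(z::'a). ennreal (norm z powr - q) * indicator (cball 0 \<rho>) z \<partial>lborel)
      \<le> ennreal (B * \<rho> powr (real DIM('a) - q))" if \<rho>: "0 < \<rho>" for \<rho>
  proof -
    define A where "A = V * 2 powr q * \<rho> powr (real n - q)"
    have A: "0 \<le> A" using V by (simp add: A_def)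
    let ?f = "\<lambda>k (z::'a). ennreal (((1/2) ^ Suc k * \<rho>) powr - q) * indicator (cball 0 ((1/2) ^ k * \<rho>)) z"
    have le: "ennreal (norm z powr - q) * indicator (cball 0 \<rho>) z \<le> (\<Sum>k. ?f k z)" for z :: 'a
    \<comment> \<open>No shell contains the origin, but there \<open>0 powr - q\<close> is 0 by
      convention.\<close>
    proof (cases "z \<noteq> 0 \<and> norm z \<le> \<rho>")
      case True
      obtain j where "(1/2) ^ j < norm z / \<rho>"
        using real_arch_pow_inv[of "norm z / \<rho>" "1/2"] True \<rho> by auto
      then have *: "(1/2) ^ j * \<rho> < norm z"
        using \<rho> by (simp add: pos_less_divide_eq)
      have "(1/2) ^ Suc j * \<rho> \<le> (1/2) ^ j * \<rho>"
        using \<rho> by (intro mult_right_mono) auto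
      also note *
      finally have "(1/2) ^ Suc j * \<rho> < norm z" .
      then have ex: "\<exists>k. (1/2) ^ Suc k * \<rho> < norm z" by blast
      define k where "k = (LEAST k. (1/2) ^ Suc k * \<rho> < norm z)"
      have low: "(1/2) ^ Suc k * \<rho> < norm z"
        unfolding k_def by (rule LeastI_ex[OF ex])
      have up: "norm z \<le> (1/2) ^ k * \<rho>"
      proof (cases k)
        case 0 then show ?thesis using True by simp
      next
        case (Suc i)
        then have "\<not> (1/2) ^ Suc i * \<rho> < norm z"
          using not_less_Least[of i "\<lambda>k. (1/2) ^ Suc k * \<rho> < norm z"] by (simp add: k_def)
        then show ?thesis using Suc by simp
      qed
      have "norm z powr - q \<le> ((1/2) ^ Suc k * \<rho>) powr - q"
        using low \<rho> q by (intro powr_mono2') auto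
      then have "ennreal (norm z powr - q) * indicator (cball 0 \<rho>) z \<le> ?f k z"
        using True up by (simp add: ennreal_leI)
      also have "\<dots> \<le> (\<Sum>k. ?f k z)"
        by (rule term_le_suminf_ennreal)
      finally show ?thesis .
    qed auto
    have "(\<integral>\<^sup>+(z::'a). ennreal (norm z powr - q) * indicator (cball 0 \<rho>) z \<partial>lborel)
        \<le> (\<integral>\<^sup>+z. (\<Sum>k. ?f k z) \<partial>lborel)"
      by (intro nn_integral_mono le)
    also have "\<dots> = (\<Sum>k. \<integral>\<^sup>+z. ?f k z \<partial>lborel)"
      by (intro nn_integral_suminf borel_measurable_times_ennreal borel_measurable_const
        borel_measurable_indicator) simp
    also have "\<dots> = (\<Sum>k. ennreal (A * a ^ k))"
    proof (intro suminf_cong)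
      fix k
      have "(\<integral>\<^sup>+z. ?f k z \<partial>lborel) = ennreal (((1/2) ^ Suc k * \<rho>) powr - q * (V * ((1/2) ^ k * \<rho>) ^ n))"
        using \<rho> V
        by (subst nn_integral_cmult_indicator)
           (auto simp: emeasure_cball V_def n_def ennreal_mult)
      also have "((1/2) ^ Suc k * \<rho>) powr - q * (V * ((1/2) ^ k * \<rho>) ^ n) = A * a ^ k"
      proof -
        define w where "w = (1/2) ^ k * \<rho>"
        have w: "w > 0" using \<rho> by (simp add: w_def)
        have "((1/2) ^ Suc k * \<rho>) powr - q * (V * ((1/2) ^ k * \<rho>) ^ n) = ((1/2) * w) powr - q * (V * w ^ n)"
          by (simp add: w_def)
        also have "\<dots> = V * 2 powr q * (w powr - q * w ^ n)"
          using w by (subst powr_mult) (simp_all add: powr_minus powr_divide)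
        also have "\<dots> = A * a ^ k"
          unfolding powr_minus_mult_power[OF w] unfolding w_def A_def a_def
          using \<rho> by (subst powr_power_mult) simp_all
        finally show ?thesis .
      qed
      finally show "(\<integral>\<^sup>+z. ?f k z \<partial>lborel) = ennreal (A * a ^ k)" .
    qed
    also have "\<dots> = ennreal (\<Sum>k. A * a ^ k)"
      using A a by (subst suminf_ennreal2) (auto intro!: summable_mult summable_geometric)
    also have "(\<Sum>k. A * a ^ k) = B * \<rho> powr (real DIM('a) - q)"
      using a by (subst suminf_mult) (auto simp: A_def B_def n_def intro!: summable_geometric)
    finally show ?thesis .
  qed
  ultimately show ?thesis using that by blast
qed

section \<open>Second differences of Hoelder functions\<close>

lemma abs_frechet_derivative_le:
  fixes f :: "'a::euclidean_space \<Rightarrow> real"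
  assumes "f differentiable (at x)"
  shows "\<bar>frechet_derivative f (at x) h\<bar> \<le> norm h * (\<Sum>b\<in>Basis. \<bar>frechet_derivative f (at x) b\<bar>)"
proof -
  have lin: "linear (frechet_derivative f (at x))"
    using assms by (rule linear_frechet_derivative)
  have "frechet_derivative f (at x) h = frechet_derivative f (at x) (\<Sum>b\<in>Basis. (h \<bullet> b) *\<^sub>R b)"
    by (simp add: euclidean_representation)
  also have "\<dots> = (\<Sum>b\<in>Basis. (h \<bullet> b) * frechet_derivative f (at x) b)"
    by (simp add: linear_sum[OF lin] linear_cmul[OF lin])
  also have "\<bar>\<dots>\<bar> \<le> (\<Sum>b\<in>Basis. \<bar>(h \<bullet> b) * frechet_derivative f (at x) b\<bar>)"
    by (rule sum_abs)
  also have "\<dots> \<le> (\<Sum>b\<in>Basis. norm h * \<bar>frechet_derivative f (at x) b\<bar>)"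
    by (intro sum_mono) (auto simp: abs_mult intro!: mult_right_mono Basis_le_norm)
  finally show ?thesis by (simp add: sum_distrib_left)
qed

lemma Ck_Holder_continuous_on:
  "Ck_Holder k \<beta> S f \<Longrightarrow> continuous_on S f"
  by (cases k) (auto intro: differentiable_imp_continuous_on)

lemma has_derivative_along_line:
  fixes f :: "'a::euclidean_space \<Rightarrow> real"
  assumes "f differentiable (at (y + t *\<^sub>R h))"
  shows "((\<lambda>t. f (y + t *\<^sub>R h)) has_real_derivative frechet_derivative f (at (y + t *\<^sub>R h)) h) (at t)"
proof -
  let ?D = "frechet_derivative f (at (y + t *\<^sub>R h))"
  have "(f has_derivative ?D) (at (y + t *\<^sub>R h))"
    using assms by (simp add: frechet_derivative_works)
  moreover have "((\<lambda>t. y + t *\<^sub>R h) has_derivative (\<lambda>u. u *\<^sub>R h)) (at t)"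
    by (auto intro!: derivative_eq_intros)
  ultimately have "((\<lambda>t. f (y + t *\<^sub>R h)) has_derivative (\<lambda>u. ?D (u *\<^sub>R h))) (at t)"
    by (rule has_derivative_compose[rotated])
  moreover have "(\<lambda>u. ?D (u *\<^sub>R h)) = (*) (?D h)"
    using linear_cmul[OF linear_frechet_derivative[OF assms]] by (auto simp: mult.commute)
  ultimately show ?thesis
    by (simp add: has_field_derivative_def)
qed

text \<open>The partial derivatives are continuous, hence bounded on a compact ball, and the mean
  value theorem applies along segments. Used for the partial derivatives themselves when the integer
  part of \<alpha> is at least 2.\<close>

lemma Ck_Holder_Suc_locally_Lipschitz:
  fixes f :: "'a::euclidean_space \<Rightarrow> real"
  assumes S: "open S" "x \<in> S" and f: "Ck_Holder (Suc k) \<beta> S f"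
  obtains r C where "0 < r" "\<And>y z. y \<in> ball x r \<Longrightarrow> z \<in> ball x r \<Longrightarrow> \<bar>f y - f z\<bar> \<le> C * dist y z"
proof -
  obtain r where r: "0 < r" "cball x r \<subseteq> S"
    using S open_contains_cball by blast
  have diff: "f differentiable (at y)" if "y \<in> S" for y
    using f that by (simp add: differentiable_on_eq_differentiable_at[OF S(1)])
  define g where "g y = (\<Sum>b\<in>Basis. \<bar>frechet_derivative f (at y) b\<bar>)" for y
  have "continuous_on (cball x r) g"
    unfolding g_def
  proof (intro continuous_intros)
    fix b :: 'a assume "b \<in> Basis"
    then have "Ck_Holder k \<beta> S (\<lambda>y. frechet_derivative f (at y) b)"
      using f by simp
    then show "continuous_on (cball x r) (\<lambda>y. frechet_derivative f (at y) b)"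
      using r(2) by (meson Ck_Holder_continuous_on continuous_on_subset)
  qed
  then have "bounded (g ` cball x r)"
    by (intro compact_imp_bounded compact_continuous_image) auto
  then obtain C where C: "\<And>y. y \<in> cball x r \<Longrightarrow> \<bar>g y\<bar> \<le> C"
    unfolding bounded_iff by (metis imageI real_norm_def)
  show ?thesis
  proof (rule that[OF r(1)])
    fix y z assume y: "y \<in> ball x r" and z: "z \<in> ball x r"
    have seg: "z + t *\<^sub>R (y - z) \<in> cball x r" if "0 \<le> t" "t \<le> 1" for t
    proof -
      have "(1 - t) *\<^sub>R z + t *\<^sub>R y \<in> ball x r"
        using convex_ball[of x r] y z that by (auto simp: convex_alt)
      then show ?thesis by (simp add: algebra_simps)
    qed
    have "((\<lambda>t. f (z + t *\<^sub>R (y - z))) has_real_derivative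
        frechet_derivative f (at (z + t *\<^sub>R (y - z))) (y - z)) (at t)" if "0 \<le> t" "t \<le> 1" for t
      using seg[OF that] r(2) by (intro has_derivative_along_line diff) auto
    from MVT2[OF zero_less_one this]
    obtain t where t: "0 < t" "t < 1"
      and eq: "f y - f z = frechet_derivative f (at (z + t *\<^sub>R (y - z))) (y - z)"
      by auto
    have "z + t *\<^sub>R (y - z) \<in> cball x r"
      using seg t by auto
    then have "\<bar>frechet_derivative f (at (z + t *\<^sub>R (y - z))) (y - z)\<bar> \<le> norm (y - z) * C"
      using abs_frechet_derivative_le[OF diff, of "z + t *\<^sub>R (y - z)" "y - z"] r(2)
        mult_left_mono[of "g (z + t *\<^sub>R (y - z))" C "norm (y - z)"] C[of "z + t *\<^sub>R (y - z)"]
      by (auto simp: g_def)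
    then show "\<bar>f y - f z\<bar> \<le> C * dist y z"
      using eq by (simp add: dist_norm mult.commute)
  qed
qed

text \<open>The second difference is a difference of first derivatives in direction \<open>h\<close>
  at two points at most \<open>2 * norm h\<close> apart: one factor \<open>norm h\<close> comes from
  the direction, \<open>norm h powr \<sigma>\<close> from the Hoelder condition. The bound is
  uniform in the centre \<open>y\<close>, since it will be used at centres other than
  \<open>x\<close>.\<close>

lemma second_difference_le:
  fixes f :: "'a::euclidean_space \<Rightarrow> real"
  assumes S: "open S" "x \<in> S" and f: "f differentiable_on S" and \<sigma>: "0 \<le> \<sigma>"
    and D: "\<And>b. b \<in> Basis \<Longrightarrow> \<exists>r>0. \<exists>C. \<forall>y\<in>ball x r. \<forall>z\<in>ball x r.
        \<bar>frechet_derivative f (at y) b - frechet_derivative f (at z) b\<bar> \<le> C * dist y z powr \<sigma>"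
  obtains r C where "0 < r" "ball x (2 * r) \<subseteq> S"
    "\<And>y h. y \<in> ball x r \<Longrightarrow> norm h < r \<Longrightarrow> \<bar>f (y + h) + f (y - h) - 2 * f y\<bar> \<le> C * norm h powr (1 + \<sigma>)"
proof -
  obtain R C where RC: "\<And>b. b \<in> Basis \<Longrightarrow> 0 < R b"
    "\<And>b y z. b \<in> Basis \<Longrightarrow> y \<in> ball x (R b) \<Longrightarrow> z \<in> ball x (R b) \<Longrightarrow>
       \<bar>frechet_derivative f (at y) b - frechet_derivative f (at z) b\<bar> \<le> C b * dist y z powr \<sigma>"
    using D by metis
  obtain r0 where r0: "0 < r0" "ball x r0 \<subseteq> S"
    using S openE by blast
  define r1 where "r1 = min r0 (Min (R ` Basis))"
  have r1: "0 < r1" "r1 \<le> r0" "\<And>b. b \<in> Basis \<Longrightarrow> r1 \<le> R b"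
    using r0 RC(1) by (auto simp: r1_def min_le_iff_disj)
  define B where "B = (\<Sum>b\<in>(Basis::'a set). \<bar>C b\<bar>)"
  have diff: "f differentiable (at y)" if "y \<in> ball x r1" for y
    using f that r0(2) r1(2) by (force simp: differentiable_on_eq_differentiable_at[OF S(1)])
  show ?thesis
  \<comment> \<open>Halving \<open>r1\<close> keeps the segment from \<open>y - h\<close> to
    \<open>y + h\<close> inside the ball; \<open>2 powr \<sigma>\<close> comes from the distance
    \<open>2 * norm h\<close>.\<close>
  proof (rule that[of "r1/2" "B * 2 powr \<sigma>"])
    show "0 < r1/2" "ball x (2 * (r1/2)) \<subseteq> S" using r1(1,2) r0(2) by auto
    fix y h :: 'a assume y: "y \<in> ball x (r1/2)" and h: "norm h < r1/2"
    have seg: "y + t *\<^sub>R h \<in> ball x r1" "y + t *\<^sub>R (- h) \<in> ball x r1" if "0 \<le> t" "t \<le> 1" for t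
    proof -
      have "norm (t *\<^sub>R h) \<le> 1 * norm h" using that by (simp add: mult_left_le_one_le)
      then have "norm (x - (y + t *\<^sub>R h)) < r1" "norm (x - (y - t *\<^sub>R h)) < r1"
        using y h norm_triangle_ineq4[of "x - y" "t *\<^sub>R h"] norm_triangle_ineq[of "x - y" "t *\<^sub>R h"]
        by (simp_all add: dist_norm algebra_simps)
      then show "y + t *\<^sub>R h \<in> ball x r1" "y + t *\<^sub>R (- h) \<in> ball x r1"
        by (simp_all add: dist_norm)
    qed
    let ?D = "\<lambda>y. frechet_derivative f (at y)"
    have lin: "?D (y + t *\<^sub>R (- h)) (- h) = - ?D (y + t *\<^sub>R (- h)) h" if "0 \<le> t" "t \<le> 1" for t
      using linear_neg[OF linear_frechet_derivative[OF diff[OF seg(2)[OF that]]]] .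
    \<comment> \<open>The mean value theorem is applied to the sum of both branches, so that the two
      derivatives are taken at the same parameter \<open>t\<close>.\<close>
    have "((\<lambda>t. f (y + t *\<^sub>R h) + f (y + t *\<^sub>R (- h))) has_real_derivative
             ?D (y + t *\<^sub>R h) h + ?D (y + t *\<^sub>R (- h)) (- h)) (at t)" if "0 \<le> t" "t \<le> 1" for t
      by (intro DERIV_add has_derivative_along_line diff seg that)
    from MVT2[OF zero_less_one this]
    obtain t where t: "0 < t" "t < 1"
      and eq: "f (y + h) + f (y - h) - 2 * f y = ?D (y + t *\<^sub>R h) h + ?D (y + t *\<^sub>R (- h)) (- h)"
      by auto
    let ?u = "y + t *\<^sub>R h" and ?w = "y + t *\<^sub>R (- h)"
    have us: "?u \<in> ball x r1" "?w \<in> ball x r1" using seg t by auto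
    have linu: "linear (?D ?u)" and linw: "linear (?D ?w)"
      using us diff by (auto intro: linear_frechet_derivative)
    define E where "E = (\<Sum>b\<in>Basis. (h \<bullet> b) * (?D ?u b - ?D ?w b))"
    have "?D ?u h + ?D ?w (- h) = E"
    proof -
      have "?D p h = (\<Sum>b\<in>Basis. (h \<bullet> b) * ?D p b)" if "linear (?D p)" for p
        using linear_sum[OF that, of "\<lambda>b. (h \<bullet> b) *\<^sub>R b" Basis]
        by (simp add: euclidean_representation linear_cmul[OF that])
      from this[OF linu] this[OF linw] linear_neg[OF linw, of h] show ?thesis
        by (simp only: E_def right_diff_distrib sum_subtractf add_uminus_conv_diff)
    qed
    then have E: "f (y + h) + f (y - h) - 2 * f y = E"
      using eq by simp
    have "\<bar>E\<bar> \<le> (\<Sum>b\<in>Basis. \<bar>(h \<bullet> b) * (?D ?u b - ?D ?w b)\<bar>)"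
      unfolding E_def by (rule sum_abs)
    also have "\<dots> \<le> (\<Sum>b\<in>Basis. norm h * (\<bar>C b\<bar> * (2 * norm h) powr \<sigma>))"
    proof (intro sum_mono)
      fix b :: 'a assume b: "b \<in> Basis"
      have "dist ?u ?w \<le> 2 * norm h"
      proof -
        have "?u - ?w = (2 * t) *\<^sub>R h" by (simp add: algebra_simps flip: scaleR_2)
        then show ?thesis using t by (simp add: dist_norm mult_left_le_one_le)
      qed
      then have "dist ?u ?w powr \<sigma> \<le> (2 * norm h) powr \<sigma>"
        using \<sigma> by (intro powr_mono2) auto
      then have le: "\<bar>C b\<bar> * dist ?u ?w powr \<sigma> \<le> \<bar>C b\<bar> * (2 * norm h) powr \<sigma>"
        by (intro mult_left_mono) auto
      have "\<bar>?D ?u b - ?D ?w b\<bar> \<le> C b * dist ?u ?w powr \<sigma>"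
        using us r1(3)[OF b] by (intro RC(2)[OF b]) auto
      also have "\<dots> \<le> \<bar>C b\<bar> * dist ?u ?w powr \<sigma>"
        by (intro mult_right_mono) auto
      also note le
      finally have "\<bar>?D ?u b - ?D ?w b\<bar> \<le> \<bar>C b\<bar> * (2 * norm h) powr \<sigma>" .
      then show "\<bar>(h \<bullet> b) * (?D ?u b - ?D ?w b)\<bar> \<le> norm h * (\<bar>C b\<bar> * (2 * norm h) powr \<sigma>)"
        unfolding abs_mult by (intro mult_mono Basis_le_norm b) auto
    qed
    also have "\<dots> = B * 2 powr \<sigma> * norm h powr (1 + \<sigma>)"
      by (cases "h = 0") (simp_all add: B_def powr_mult powr_add sum_distrib_right sum_distrib_left mult_ac)
    finally show "\<bar>f (y + h) + f (y - h) - 2 * f y\<bar> \<le> B * 2 powr \<sigma> * norm h powr (1 + \<sigma>)"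
      unfolding E .
  qed
qed

text \<open>For \<open>\<alpha> > 2\<gamma>\<close> the exponent exceeds \<open>2\<gamma>\<close>, so the symmetrised difference quotients of a
  \<open>C\<^sup>\<alpha>\<close> function are integrable against the kernel.\<close>

lemma Holder_space_second_difference:
  fixes f :: "'a::euclidean_space \<Rightarrow> real"
  assumes S: "open S" "x \<in> S" and f: "f \<in> Holder_space \<alpha> S" and \<alpha>: "0 < \<alpha>"
  obtains r C where "0 < r" "ball x (2 * r) \<subseteq> S"
    "\<And>y h. y \<in> ball x r \<Longrightarrow> norm h < r \<Longrightarrow> \<bar>f (y + h) + f (y - h) - 2 * f y\<bar> \<le> C * norm h powr (min \<alpha> 2)"
proof -
  define k where "k = nat \<lfloor>\<alpha>\<rfloor>"
  have Ck: "Ck_Holder k (frac \<alpha>) S f" using f by (simp add: Holder_space_def k_def)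
  have k: "real k + frac \<alpha> = \<alpha>" using \<alpha> by (simp add: k_def frac_def)
  \<comment> \<open>The cases differ in what carries the Hoelder condition: \<open>f\<close> itself,
    its gradient with exponent \<open>frac \<alpha>\<close>, or a gradient that is locally
    Lipschitz; in the last case the exponent saturates at 2.\<close>
  consider "k = 0" | "k = 1" | j where "k = Suc (Suc j)"
    by (metis One_nat_def not0_implies_Suc)
  then show ?thesis
  proof cases
    case 1
    obtain r0 where r0: "0 < r0" "ball x r0 \<subseteq> S"
      using S openE by blast
    obtain r1 C where r1: "0 < r1" and C: "\<And>y z. y \<in> ball x r1 \<inter> S \<Longrightarrow> z \<in> ball x r1 \<inter> S \<Longrightarrow>
        \<bar>f y - f z\<bar> \<le> C * dist y z powr \<alpha>"
    proof -
      have "\<forall>x\<in>S. \<exists>r>0. \<exists>C. \<forall>y\<in>ball x r \<inter> S. \<forall>z\<in>ball x r \<inter> S. \<bar>f y - f z\<bar> \<le> C * dist y z powr \<alpha>"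
        using Ck k unfolding 1 by simp
      then show ?thesis using S(2) that by blast
    qed
    define r where "r = min r0 r1 / 2"
    have \<alpha>2: "min \<alpha> 2 = \<alpha>" using k 1 frac_lt_1[of \<alpha>] by simp
    show ?thesis
    proof (rule that[of r "2 * C"])
      show "0 < r" "ball x (2 * r) \<subseteq> S" using r0 r1 by (auto simp: r_def)
      fix y h :: 'a assume y: "y \<in> ball x r" and h: "norm h < r"
      have "norm (x - (y + h)) < 2 * r" "norm (x - (y - h)) < 2 * r" "norm (x - y) < 2 * r"
        using y h norm_triangle_ineq4[of "x - y" h] norm_triangle_ineq[of "x - y" h] \<open>0 < r\<close>
        by (simp_all add: dist_norm algebra_simps)
      then have "y \<in> ball x r1 \<inter> S" "y + h \<in> ball x r1 \<inter> S" "y - h \<in> ball x r1 \<inter> S"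
        using r0(2) by (auto simp: r_def dist_norm subset_eq)
      then have "\<bar>f (y + h) - f y\<bar> \<le> C * norm h powr \<alpha>" "\<bar>f (y - h) - f y\<bar> \<le> C * norm h powr \<alpha>"
        using C[of "y + h" y] C[of "y - h" y] by (simp_all add: dist_norm)
      then show "\<bar>f (y + h) + f (y - h) - 2 * f y\<bar> \<le> 2 * C * norm h powr (min \<alpha> 2)"
        unfolding \<alpha>2 by linarith
    qed
  next
    case 2
    obtain r0 where r0: "0 < r0" "ball x r0 \<subseteq> S"
      using S openE by blast
    have D: "\<exists>r>0. \<exists>C. \<forall>y\<in>ball x r. \<forall>z\<in>ball x r.
        \<bar>frechet_derivative f (at y) b - frechet_derivative f (at z) b\<bar> \<le> C * dist y z powr frac \<alpha>"
      if b: "b \<in> Basis" for b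
    proof -
      obtain r1 C where "0 < r1" "\<forall>y\<in>ball x r1 \<inter> S. \<forall>z\<in>ball x r1 \<inter> S.
          \<bar>frechet_derivative f (at y) b - frechet_derivative f (at z) b\<bar> \<le> C * dist y z powr frac \<alpha>"
        using Ck S(2) b unfolding 2 One_nat_def Ck_Holder.simps by blast
      with r0 show ?thesis
        by (intro exI[of _ "min r0 r1"] conjI exI[of _ C]) (auto simp: subset_eq)
    qed
    have \<alpha>2: "min \<alpha> 2 = 1 + frac \<alpha>" using k 2 frac_lt_1[of \<alpha>] by simp
    have "f differentiable_on S" using Ck by (simp add: 2)
    from second_difference_le[OF S this frac_ge_0 D]
    obtain r C where "0 < r" "ball x (2 * r) \<subseteq> S" "\<And>y h. y \<in> ball x r \<Longrightarrow> norm h < r \<Longrightarrow>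
        \<bar>f (y + h) + f (y - h) - 2 * f y\<bar> \<le> C * norm h powr (1 + frac \<alpha>)"
      by blast
    then show ?thesis
      by (rule that[unfolded \<alpha>2])
  next
    case (3 j)
    have D: "\<exists>r>0. \<exists>C. \<forall>y\<in>ball x r. \<forall>z\<in>ball x r.
        \<bar>frechet_derivative f (at y) b - frechet_derivative f (at z) b\<bar> \<le> C * dist y z powr 1"
      if b: "b \<in> Basis" for b
    proof -
      have "Ck_Holder (Suc j) (frac \<alpha>) S (\<lambda>y. frechet_derivative f (at y) b)"
        using Ck b unfolding 3 by simp
      from Ck_Holder_Suc_locally_Lipschitz[OF S this] show ?thesis
        by (metis powr_one zero_le_dist)
    qed
    have "2 \<le> \<alpha>" using k 3 frac_ge_0[of \<alpha>] by linarith
    then have \<alpha>2: "min \<alpha> 2 = 1 + 1" by simp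
    have "f differentiable_on S" using Ck by (simp add: 3)
    from second_difference_le[OF S this zero_le_one D]
    obtain r C where "0 < r" "ball x (2 * r) \<subseteq> S" "\<And>y h. y \<in> ball x r \<Longrightarrow> norm h < r \<Longrightarrow>
        \<bar>f (y + h) + f (y - h) - 2 * f y\<bar> \<le> C * norm h powr (1 + 1)"
      by blast
    then show ?thesis
      by (rule that[unfolded \<alpha>2])
  qed
qed

section \<open>The averaged kernel\<close>

lemma continuous_on_matrix_vector_mult_fst:
  "continuous_on UNIV (\<lambda>R :: real^'n^'m. R *v x)"
  unfolding matrix_vector_mult_def
  by (intro continuous_on_vec_lambda continuous_on_sum continuous_on_mult continuous_on_const
      continuous_on_component continuous_on_id)

lemma borel_measurable_act2_diff:
  "(\<lambda>(R, y). act2 R x - y) \<in> borel_measurable (borel \<Otimes>\<^sub>M (borel :: ('m::finite) dbl measure))"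
proof -
  have "continuous_on UNIV (\<lambda>p::'m mat2 \<times> 'm dbl. act2 (fst p) x - snd p)"
  proof -
    have c: "continuous_on UNIV (\<lambda>p::'m mat2 \<times> 'm dbl. g p *v a)"
      if "continuous_on UNIV g" for g :: "'m mat2 \<times> 'm dbl \<Rightarrow> real^'m^'m" and a
      using continuous_on_compose2[OF continuous_on_matrix_vector_mult_fst that] by auto
    show ?thesis
      unfolding act2_def by (intro continuous_intros c)
  qed
  then have "(\<lambda>p::'m mat2 \<times> 'm dbl. act2 (fst p) x - snd p) \<in> borel_measurable borel"
    by (rule borel_measurable_continuous_onI)
  then show ?thesis
    by (simp add: borel_prod case_prod_beta)
qed

lemma norm_orthogonal_matrix_mult:
  fixes R :: "real^'m^'m"
  assumes "orthogonal_matrix R"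
  shows "norm (R *v a) = norm a"
  using assms orthogonal_transformation_norm[of "(*v) R"] by (simp add: orthogonal_transformation_matrix)

lemma
  fixes R :: "('m::finite) mat2"
  assumes R: "R \<in> O2"
  shows norm_act2: "norm (act2 R x) = norm x"
    and norm_fst_act2: "norm (fst (act2 R x)) = norm (fst x)"
    and norm_snd_act2: "norm (snd (act2 R x)) = norm (snd x)"
  using R by (auto simp: act2_def O2_def norm_orthogonal_matrix_mult norm_Pair norm_prod_def)

lemma act2_diff: "act2 R x - act2 R y = act2 R (x - y)"
  by (simp add: act2_def matrix_vector_mult_diff_distrib)

lemma surj_act2:
  fixes R :: "('m::finite) mat2"
  assumes "R \<in> O2"
  shows "surj (act2 R)"
proof (rule surjI)
  show "act2 R (act2 (transpose (fst R), transpose (snd R)) x) = x" for x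
    using assms unfolding act2_def O2_def orthogonal_matrix_def
    by (simp only: fst_conv snd_conv matrix_vector_mul_assoc mem_Collect_eq matrix_vector_mul_lid prod.collapse)
qed

section \<open>Averaging over O(m)^2 and comparing the kernel with its reflection\<close>

lemma measurable_act2_diff_pair:
  fixes x :: "('m::finite) dbl" and k :: "'m dbl \<Rightarrow> ennreal"
  assumes \<mu>: "normalized_Haar_O2 \<mu>" and k: "k \<in> borel_measurable borel"
  shows "(\<lambda>(R, y). k (act2 R x - y)) \<in> borel_measurable (\<mu> \<Otimes>\<^sub>M lebesgue)"
proof -
  have sets: "sets \<mu> = sets (restrict_space borel O2)"
    using \<mu> by (auto simp: normalized_Haar_O2_def)
  have "(\<lambda>R. R) \<in> \<mu> \<rightarrow>\<^sub>M borel"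
    using measurable_ident[of borel, THEN measurable_restrict_space1, of O2]
    by (simp add: measurable_cong_sets[OF sets refl] id_def)
  then have 1: "(\<lambda>p. fst p) \<in> \<mu> \<Otimes>\<^sub>M (lebesgue :: 'm dbl measure) \<rightarrow>\<^sub>M borel"
    by (rule measurable_compose[OF measurable_fst])
  have "(\<lambda>y. y) \<in> (lebesgue :: 'm dbl measure) \<rightarrow>\<^sub>M borel"
    by (rule measurable_completion) simp
  then have 2: "(\<lambda>p. snd p) \<in> \<mu> \<Otimes>\<^sub>M (lebesgue :: 'm dbl measure) \<rightarrow>\<^sub>M borel"
    by (rule measurable_compose[OF measurable_snd])
  from measurable_compose[OF measurable_compose[OF measurable_Pair[OF 1 2] borel_measurable_act2_diff] k]
  show ?thesis by (simp add: case_prod_beta)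
qed

text \<open>For each fixed \<open>R\<close> the substitution of \<open>act2 R y\<close> for
  \<open>y\<close> changes neither \<open>g\<close> nor, by radial symmetry, the distance seen by
  \<open>K\<close>; so \<open>x\<close> may be replaced by \<open>act2 R x\<close>. Averaging over
  \<open>R\<close> and exchanging the integrals produces the averaged kernel. The Borel function
  \<open>k\<close> stands in for \<open>K\<close> to make the integrand jointly measurable.\<close>

lemma nn_integral_doubly_radial_Haar:
  fixes x :: "('m::finite) dbl" and g k :: "'m dbl \<Rightarrow> ennreal"
  assumes \<mu>: "normalized_Haar_O2 \<mu>"
    and g: "g \<in> borel_measurable lebesgue"
    and rad: "\<And>y z. norm (fst y) = norm (fst z) \<Longrightarrow> norm (snd y) = norm (snd z) \<Longrightarrow> g y = g z"
    and k: "k \<in> borel_measurable borel"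
    and K: "K \<in> borel_measurable lebesgue" "radially_symmetric K"
    and ae: "AE z in lebesgue. k z = ennreal (K z)"
  shows "(\<integral>\<^sup>+y. g y * ennreal (K (x - y)) \<partial>lebesgue)
       = (\<integral>\<^sup>+y. g y * (\<integral>\<^sup>+R. k (act2 R x - y) \<partial>\<mu>) \<partial>lebesgue)"
proof -
  interpret \<mu>: prob_space \<mu> using \<mu> by (simp add: normalized_Haar_O2_def)
  have sp: "space \<mu> = O2" and sets: "sets \<mu> = sets (restrict_space borel O2)"
    using \<mu> by (auto simp: normalized_Haar_O2_def)
  interpret L: sigma_finite_measure "lebesgue :: 'm dbl measure"
    by (rule sigma_finite_lebesgue)
  interpret P: pair_sigma_finite \<mu> "lebesgue :: 'm dbl measure" ..
  note meas = measurable_act2_diff_pair[OF \<mu> k, of x]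
  have inv: "(\<integral>\<^sup>+y. g y * ennreal (K (x - y)) \<partial>lebesgue) = (\<integral>\<^sup>+y. g y * k (act2 R x - y) \<partial>lebesgue)"
    if R: "R \<in> O2" for R
  proof -
    have iso1: "dist (act2 R y) (act2 R z) = dist y z" for y z
      by (simp add: dist_norm act2_diff norm_act2[OF R])
    have meas2: "(\<lambda>y. g y * ennreal (K (act2 R x - y))) \<in> borel_measurable lebesgue"
      using measurable_compose[OF measurable_lebesgue_isometry[OF dist_reflect surj_reflect] K(1)] g
      by measurable
    have "(\<integral>\<^sup>+y. g y * ennreal (K (x - y)) \<partial>lebesgue)
        = (\<integral>\<^sup>+y. g (act2 R y) * ennreal (K (act2 R x - act2 R y)) \<partial>lebesgue)"
    \<comment> \<open>The point \<open>y = x\<close> is discarded as a null set, because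
      \<open>radially_symmetric\<close> gives no information at the origin.\<close>
    proof (intro nn_integral_cong_AE, rule AE_I')
      show "{x} \<in> null_sets lebesgue" by (simp add: null_sets_completion_iff)
      have "g (act2 R y) = g y" for y
        by (rule rad) (simp_all add: norm_fst_act2[OF R] norm_snd_act2[OF R])
      moreover have "K (act2 R x - act2 R y) = K (x - y)" if "y \<noteq> x" for y
      proof -
        have "norm (x - y) = norm (act2 R x - act2 R y)"
          by (simp add: act2_diff norm_act2[OF R])
        then show ?thesis
          using K(2) that unfolding radially_symmetric_def by (metis right_minus_eq)
      qed
      ultimately show "{y \<in> space lebesgue. g y * ennreal (K (x - y))
          \<noteq> g (act2 R y) * ennreal (K (act2 R x - act2 R y))} \<subseteq> {x}"
        by (intro subsetI) (metis (mono_tags, lifting) mem_Collect_eq singletonI)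
    qed
    also have "\<dots> = (\<integral>\<^sup>+y. g y * ennreal (K (act2 R x - y)) \<partial>lebesgue)"
      by (rule nn_integral_lebesgue_isometry[OF iso1 surj_act2[OF R] meas2])
    also have "\<dots> = (\<integral>\<^sup>+y. g y * k (act2 R x - y) \<partial>lebesgue)"
    proof (rule nn_integral_cong_AE)
      have "AE y in distr lebesgue lebesgue (\<lambda>y. act2 R x - y). k y = ennreal (K y)"
        unfolding distr_lebesgue_isometry[OF dist_reflect surj_reflect] by (rule ae)
      then have "AE y in lebesgue. k (act2 R x - y) = ennreal (K (act2 R x - y))"
        by (rule AE_distrD[OF measurable_lebesgue_isometry[OF dist_reflect surj_reflect]])
      then show "AE y in lebesgue. g y * ennreal (K (act2 R x - y)) = g y * k (act2 R x - y)"
        by (auto elim: eventually_mono)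
    qed
    finally show ?thesis .
  qed
  have "(\<integral>\<^sup>+y. g y * ennreal (K (x - y)) \<partial>lebesgue)
      = (\<integral>\<^sup>+R. (\<integral>\<^sup>+y. g y * ennreal (K (x - y)) \<partial>lebesgue) \<partial>\<mu>)"
    by (simp add: \<mu>.emeasure_space_1)
  also have "\<dots> = (\<integral>\<^sup>+R. (\<integral>\<^sup>+y. g y * k (act2 R x - y) \<partial>lebesgue) \<partial>\<mu>)"
    by (intro nn_integral_cong inv) (simp add: sp)
  also have "\<dots> = (\<integral>\<^sup>+y. (\<integral>\<^sup>+R. g y * k (act2 R x - y) \<partial>\<mu>) \<partial>lebesgue)"
  proof (rule P.Fubini'[symmetric])
    show "(\<lambda>(R, y). g y * k (act2 R x - y)) \<in> borel_measurable (\<mu> \<Otimes>\<^sub>M lebesgue)"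
      using meas measurable_compose[OF measurable_snd g] unfolding case_prod_beta
      by (intro borel_measurable_times_ennreal)
  qed
  also have "\<dots> = (\<integral>\<^sup>+y. g y * (\<integral>\<^sup>+R. k (act2 R x - y) \<partial>\<mu>) \<partial>lebesgue)"
    using measurable_compose[OF measurable_Pair2' meas]
    by (intro nn_integral_cong nn_integral_cmult) (simp only: prod.case)
  finally show ?thesis .
qed

text \<open>Since \<open>K\<close> is only Lebesgue measurable, the integrand of \<^const>\<open>Kbar\<close> need not be measurable;
  it is squeezed between a Borel minorant and a Borel majorant of \<open>K\<close>, which agree almost
  everywhere.\<close>

lemma nn_integral_reflected_kernel_le:
  fixes x :: "('m::finite) dbl" and g :: "'m dbl \<Rightarrow> ennreal" and K :: "'m dbl \<Rightarrow> real"
  assumes \<mu>: "normalized_Haar_O2 \<mu>"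
    and g: "g \<in> borel_measurable lebesgue"
    and rad: "\<And>y z. norm (fst y) = norm (fst z) \<Longrightarrow> norm (snd y) = norm (snd z) \<Longrightarrow> g y = g z"
    and supp: "\<And>y. y \<notin> cone_O \<Longrightarrow> g y = 0"
    and K: "K \<in> borel_measurable lebesgue" "radially_symmetric K"
    and pos: "positivity_condition \<mu> K"
    and x: "x \<in> cone_O"
  shows "(\<integral>\<^sup>+y. g y * ennreal (K (x - star y)) \<partial>lebesgue) \<le> (\<integral>\<^sup>+y. g y * ennreal (K (x - y)) \<partial>lebesgue)"
proof -
  obtain k where k: "k \<in> borel_measurable lborel" and ae: "AE z in lborel. ennreal (K z) = k z"
    using completion_ex_borel_measurable[of "\<lambda>z. ennreal (K z)" lborel] K(1) by auto
  obtain Z where Z: "{z \<in> space lborel. ennreal (K z) \<noteq> k z} \<subseteq> Z" "Z \<in> null_sets lborel"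
    using ae by (auto elim!: AE_E intro: that) 
  \<comment> \<open>The origin joins the exceptional set so that the majorant \<open>k2\<close> is
    infinite there, as the integrand of \<open>Kbar\<close> is.\<close>
  define Z' where "Z' = insert 0 Z"
  have Z': "Z' \<in> null_sets lborel"
    unfolding Z'_def insert_is_Un[of 0 Z] using Z(2) by (intro null_sets.Un) auto
  have out: "z \<noteq> 0 \<and> k z = ennreal (K z)" if "z \<notin> Z'" for z
  proof -
    have "z \<notin> {z \<in> space lborel. ennreal (K z) \<noteq> k z}"
      using Z(1) that unfolding Z'_def by blast
    then have "k z = ennreal (K z)" by simp
    then show ?thesis using that by (simp add: Z'_def)
  qed
  have "0 \<in> Z'" by (simp add: Z'_def)
  have Zb: "Z' \<in> sets borel" using Z' by auto
  define k1 where "k1 z = (if z \<in> Z' then 0 else k z)" for z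
  define k2 where "k2 z = (if z \<in> Z' then \<infinity> else k z)" for z
  have kb: "k1 \<in> borel_measurable borel" "k2 \<in> borel_measurable borel"
    unfolding k1_def k2_def using Zb k by (auto intro!: measurable_If_set)
  have "AE z in lebesgue. z \<notin> Z'"
    using Z' by (intro AE_completion AE_not_in)
  then have ae12: "AE z in lebesgue. k1 z = ennreal (K z)" "AE z in lebesgue. k2 z = ennreal (K z)"
    by (auto elim!: eventually_mono simp: k1_def k2_def out)
  have le1: "(\<integral>\<^sup>+R. k1 (act2 R x - y) \<partial>\<mu>) \<le> Kbar \<mu> K x y" for y
    unfolding Kbar_def by (intro nn_integral_mono) (simp add: k1_def out)
  have le2: "Kbar \<mu> K x y \<le> (\<integral>\<^sup>+R. k2 (act2 R x - y) \<partial>\<mu>)" for y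
    unfolding Kbar_def by (intro nn_integral_mono) (use out \<open>0 \<in> Z'\<close> in \<open>simp add: k2_def\<close>)
  have gs: "(\<lambda>y. g (star y)) \<in> borel_measurable lebesgue"
    by (rule measurable_compose[OF measurable_lebesgue_isometry[OF dist_star surj_star] g])
  have K': "(\<lambda>y. K (x - y)) \<in> borel_measurable lebesgue"
    by (rule measurable_compose[OF measurable_lebesgue_isometry[OF dist_reflect surj_reflect] K(1)])
  have m1: "(\<lambda>y. g (star y) * ennreal (K (x - y))) \<in> borel_measurable lebesgue"
    using gs K' by measurable
  interpret \<mu>: prob_space \<mu> using \<mu> by (simp add: normalized_Haar_O2_def)
  have "(\<lambda>y. \<integral>\<^sup>+R. k1 (act2 R x - y) \<partial>\<mu>) \<in> borel_measurable lebesgue"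
    using measurable_act2_diff_pair[OF \<mu> kb(1), of x]
    by (intro \<mu>.borel_measurable_nn_integral) (simp add: measurable_pair_swap_iff[of _ lebesgue] case_prod_beta)
  then have m2: "(\<lambda>y. g (star y) * (\<integral>\<^sup>+R. k1 (act2 R x - y) \<partial>\<mu>)) \<in> borel_measurable lebesgue"
    using gs by measurable
  \<comment> \<open>Reflecting moves \<open>star\<close> from the kernel to \<open>g\<close>, which
    stays doubly radial, so the group average can be inserted; reflecting back yields
    \<open>Kbar\<close> at \<open>star y\<close>. The positivity condition then applies pointwise on
    the cone, and the average is undone.\<close>
  have "(\<integral>\<^sup>+y. g y * ennreal (K (x - star y)) \<partial>lebesgue) = (\<integral>\<^sup>+y. g (star y) * ennreal (K (x - y)) \<partial>lebesgue)"
    using nn_integral_lebesgue_isometry[OF dist_star surj_star m1] by (simp add: star_star)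
  also have "\<dots> = (\<integral>\<^sup>+y. g (star y) * (\<integral>\<^sup>+R. k1 (act2 R x - y) \<partial>\<mu>) \<partial>lebesgue)"
    by (rule nn_integral_doubly_radial_Haar[OF \<mu> gs _ kb(1) K ae12(1)]) (rule rad, simp_all add: star_def)
  also have "\<dots> = (\<integral>\<^sup>+y. g y * (\<integral>\<^sup>+R. k1 (act2 R x - star y) \<partial>\<mu>) \<partial>lebesgue)"
    using nn_integral_lebesgue_isometry[OF dist_star surj_star m2] by (simp add: star_star)
  also have "\<dots> \<le> (\<integral>\<^sup>+y. g y * Kbar \<mu> K x (star y) \<partial>lebesgue)"
    by (intro nn_integral_mono mult_left_mono le1) auto
  also have "\<dots> \<le> (\<integral>\<^sup>+y. g y * (\<integral>\<^sup>+R. k2 (act2 R x - y) \<partial>\<mu>) \<partial>lebesgue)"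
  proof (rule nn_integral_mono)
    show "g y * Kbar \<mu> K x (star y) \<le> g y * (\<integral>\<^sup>+R. k2 (act2 R x - y) \<partial>\<mu>)" for y
    proof (cases "y \<in> cone_O")
      case True
      then have "Kbar \<mu> K x (star y) \<le> Kbar \<mu> K x y"
        using pos x unfolding positivity_condition_def by (simp add: less_imp_le)
      then show ?thesis using le2[of y] by (intro mult_left_mono) auto
    qed (simp add: supp)
  qed
  also have "\<dots> = (\<integral>\<^sup>+y. g y * ennreal (K (x - y)) \<partial>lebesgue)"
    by (rule nn_integral_doubly_radial_Haar[OF \<mu> g rad kb(2) K ae12(2), symmetric])
  finally show ?thesis .
qed

section \<open>Estimates for the integro-differential operator\<close>

lemma c_const_pos:
  assumes "0 < \<gamma>" "\<gamma> < 1" "0 < n"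
  shows "0 < c_const n \<gamma>"
  using assms by (simp add: c_const_def Gamma_real_pos)

lemma
  fixes K :: "'a::euclidean_space \<Rightarrow> real"
  assumes "kernel_class_L0 \<gamma> lam Lam K" "0 < \<gamma>" "\<gamma> < 1" "0 < lam" "z \<noteq> 0"
  shows kernel_class_nonneg: "0 \<le> K z"
    and kernel_class_lower: "lam * c_const DIM('a) \<gamma> * norm z powr - (real DIM('a) + 2 * \<gamma>) \<le> K z"
    and kernel_class_upper: "\<bar>K z\<bar> \<le> Lam * c_const DIM('a) \<gamma> * norm z powr - (real DIM('a) + 2 * \<gamma>)"
proof -
  have *: "lam * c_const DIM('a) \<gamma> * norm z powr (- real DIM('a) - 2 * \<gamma>) \<le> K z"
    "K z \<le> Lam * c_const DIM('a) \<gamma> * norm z powr (- real DIM('a) - 2 * \<gamma>)"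
    using assms(1,5) unfolding kernel_class_L0_def by blast+
  have "0 \<le> lam * c_const DIM('a) \<gamma> * norm z powr (- real DIM('a) - 2 * \<gamma>)"
    using c_const_pos[OF assms(2,3), of "DIM('a)"] assms(4) by simp
  with *(1) show "0 \<le> K z" by linarith
  show "lam * c_const DIM('a) \<gamma> * norm z powr - (real DIM('a) + 2 * \<gamma>) \<le> K z"
    using *(1) by simp
  from \<open>0 \<le> K z\<close> *(2) show "\<bar>K z\<bar> \<le> Lam * c_const DIM('a) \<gamma> * norm z powr - (real DIM('a) + 2 * \<gamma>)"
    by simp
qed

lemma set_integrable_kernel_outside_ball:
  fixes K :: "'a::euclidean_space \<Rightarrow> real"
  assumes K: "kernel_class_L0 \<gamma> lam Lam K" and \<gamma>: "0 < \<gamma>" "\<gamma> < 1" and lam: "0 < lam" and r: "0 < r"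
  shows "set_integrable lebesgue {z. r < norm z} K"
proof -
  have Km: "K \<in> borel_measurable lebesgue" using K by (simp add: kernel_class_L0_def)
  define A where "A = Lam * c_const DIM('a) \<gamma>"
  define p where "p = real DIM('a) + 2 * \<gamma>"
  have E: "{z :: 'a. r < norm z} \<in> sets borel" by measurable
  then have EL: "{z :: 'a. r < norm z} \<in> sets lebesgue" by simp
  have bound: "ennreal (norm (indicator {z. r < norm z} z *\<^sub>R K z))
      \<le> ennreal \<bar>A\<bar> * (ennreal (norm z powr - p) * indicator {z. r < norm z} z)" for z :: 'a
  proof (cases "r < norm z")
    case True
    then have "\<bar>K z\<bar> \<le> A * norm z powr - p"
      using kernel_class_upper[OF K \<gamma> lam, of z] r by (fastforce simp: A_def p_def)
    also have "\<dots> \<le> \<bar>A\<bar> * norm z powr - p" by (intro mult_right_mono) auto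
    finally show ?thesis using True by (simp add: ennreal_mult[symmetric] ennreal_leI)
  qed simp
  have "(\<integral>\<^sup>+z. ennreal (norm (indicator {z. r < norm z} z *\<^sub>R K z)) \<partial>lebesgue)
      \<le> (\<integral>\<^sup>+(z::'a). ennreal \<bar>A\<bar> * (ennreal (norm z powr - p) * indicator {z. r < norm z} z) \<partial>lebesgue)"
    by (intro nn_integral_mono bound)
  also have "\<dots> = (\<integral>\<^sup>+(z::'a). ennreal \<bar>A\<bar> * (ennreal (norm z powr - p) * indicator {z. r < norm z} z) \<partial>lborel)"
    by (rule nn_integral_completion)
  also have "\<dots> = ennreal \<bar>A\<bar> * (\<integral>\<^sup>+(z::'a). ennreal (norm z powr - p) * indicator {z. r < norm z} z \<partial>lborel)"
    using E by (intro nn_integral_cmult borel_measurable_times_ennreal borel_measurable_indicator) auto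
  also have "\<dots> < \<infinity>"
    using nn_integral_norm_powr_outside_ball[where 'a='a, of p r] \<gamma> r
    by (simp add: p_def ennreal_mult_less_top)
  finally show ?thesis
    unfolding set_integrable_def using Km EL
    by (intro integrableI_bounded borel_measurable_scaleR borel_measurable_indicator) auto
qed

lemma
  fixes K :: "'a::euclidean_space \<Rightarrow> real"
  assumes K: "kernel_class_L0 \<gamma> lam Lam K" and \<gamma>: "0 < \<gamma>" "\<gamma> < 1" and lam: "0 < lam" and r: "0 < r"
  shows set_integrable_kernel_outside_ball_at:
      "set_integrable lebesgue {y. r < norm (x - y)} (\<lambda>y. K (x - y))"
    and set_integral_kernel_outside_ball_at:
      "(LINT y:{y. r < norm (x - y)}|lebesgue. K (x - y)) = (LINT z:{z. r < norm z}|lebesgue. K z)"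
proof -
  have int: "integrable lebesgue (\<lambda>z. indicator {z. r < norm z} z *\<^sub>R K z)"
    using set_integrable_kernel_outside_ball[OF assms] by (simp add: set_integrable_def)
  have ind: "indicator {z. r < norm z} (x - y) = (indicator {y. r < norm (x - y)} y :: real)" for y
    by (simp add: indicator_def)
  show "set_integrable lebesgue {y. r < norm (x - y)} (\<lambda>y. K (x - y))"
    using integrable_lebesgue_isometry[OF dist_reflect[of x] surj_reflect[of x] int]
    unfolding set_integrable_def ind .
  show "(LINT y:{y. r < norm (x - y)}|lebesgue. K (x - y)) = (LINT z:{z. r < norm z}|lebesgue. K z)"
    using integral_lebesgue_isometry[OF dist_reflect[of x] surj_reflect[of x] borel_measurable_integrable[OF int]]
    unfolding set_lebesgue_integral_def ind .
qed

text \<open>Away from \<open>x\<close> the distance to \<open>x\<close> controls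
  \<open>1 + norm y\<close> up to a constant, so the kernel is bounded by a multiple of the weight
  that defines \<open>L1_weighted\<close>.\<close>

lemma set_integrable_weighted_kernel_outside_ball:
  fixes K :: "'a::euclidean_space \<Rightarrow> real"
  assumes K: "kernel_class_L0 \<gamma> lam Lam K" and \<gamma>: "0 < \<gamma>" "\<gamma> < 1" and lam: "0 < lam" and r: "0 < r"
    and w: "w \<in> L1_weighted \<gamma>"
  shows "set_integrable lebesgue {y. r < norm (x - y)} (\<lambda>y. w y * K (x - y))"
proof -
  define A where "A = Lam * c_const DIM('a) \<gamma>"
  define p where "p = real DIM('a) + 2 * \<gamma>"
  have p: "0 < p" using \<gamma> by (simp add: p_def add_nonneg_pos)
  \<comment> \<open>For \<open>d = norm (x - y)\<close> above \<open>r\<close>, the first summand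
    times \<open>d powr p\<close> dominates 1, and the second dominates
    \<open>norm y powr p\<close>.\<close>
  define a where "a = r powr - p + (norm x / r + 1) powr p"
  let ?E = "{y. r < norm (x - y)}"
  have wm: "w \<in> borel_measurable lebesgue"
    and wi: "integrable lebesgue (\<lambda>y. \<bar>w y\<bar> / (1 + norm y powr p))"
    using w by (simp_all add: L1_weighted_def p_def)
  have wi': "integrable lebesgue (\<lambda>y. \<bar>A\<bar> * a * (\<bar>w y\<bar> / (1 + norm y powr p)))"
    using wi by (rule integrable_mult_right)
  have "(\<lambda>y. indicator ?E y *\<^sub>R K (x - y)) \<in> borel_measurable lebesgue"
    using set_integrable_kernel_outside_ball_at[OF assms(1-5)] unfolding set_integrable_def
    by (rule borel_measurable_integrable)
  then have m: "(\<lambda>y. w y * (indicator ?E y *\<^sub>R K (x - y))) \<in> borel_measurable lebesgue"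
    using wm by (intro borel_measurable_times)
  have "norm (w y * (indicator ?E y *\<^sub>R K (x - y))) \<le> norm (\<bar>A\<bar> * a * (\<bar>w y\<bar> / (1 + norm y powr p)))" for y
  proof (cases "r < norm (x - y)")
    case True
    define d where "d = norm (x - y)"
    have d: "r < d" "0 < d" using True r by (auto simp: d_def)
    have "\<bar>K (x - y)\<bar> \<le> A * d powr - p"
      using kernel_class_upper[OF K \<gamma> lam, of "x - y"] d by (auto simp: A_def p_def d_def)
    also have "\<dots> \<le> \<bar>A\<bar> * d powr - p" by (intro mult_right_mono) auto
    finally have K1: "\<bar>K (x - y)\<bar> \<le> \<bar>A\<bar> * d powr - p" .
    have "norm y \<le> norm x + d"
      using norm_triangle_ineq4[of x "x - y"] by (simp add: d_def)
    also have "\<dots> \<le> (norm x / r + 1) * d"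
    proof -
      have "norm x = norm x / r * r" using r by simp
      also have "\<dots> \<le> norm x / r * d" using d r by (intro mult_left_mono) auto
      finally show ?thesis by (simp add: distrib_right)
    qed
    finally have "norm y powr p \<le> ((norm x / r + 1) * d) powr p"
      using p by (intro powr_mono2) auto
    also have "\<dots> = (norm x / r + 1) powr p * d powr p"
      using r d by (intro powr_mult)
    finally have 1: "norm y powr p \<le> (norm x / r + 1) powr p * d powr p" .
    have "r powr p \<le> d powr p" using d r p by (intro powr_mono2) auto
    then have 2: "1 \<le> r powr - p * d powr p"
      using r by (simp add: powr_minus field_simps)
    have "1 + norm y powr p \<le> a * d powr p"
      using 1 2 by (simp add: a_def distrib_right)
    then have "d powr - p \<le> a / (1 + norm y powr p)"
      using d by (simp add: powr_minus field_simps add_pos_nonneg)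
    then have "\<bar>A\<bar> * d powr - p \<le> \<bar>A\<bar> * (a / (1 + norm y powr p))"
      by (intro mult_left_mono) auto
    with K1 have "\<bar>K (x - y)\<bar> \<le> \<bar>A\<bar> * (a / (1 + norm y powr p))" by linarith
    then have "\<bar>w y\<bar> * \<bar>K (x - y)\<bar> \<le> \<bar>w y\<bar> * (\<bar>A\<bar> * (a / (1 + norm y powr p)))"
      by (intro mult_left_mono) auto
    also have "\<dots> \<le> \<bar>\<bar>A\<bar> * a * (\<bar>w y\<bar> / (1 + norm y powr p))\<bar>"
      by (rule order_trans[OF _ abs_ge_self]) (simp add: mult_ac)
    finally show ?thesis using True by (simp add: abs_mult)
  qed simp
  then have "integrable lebesgue (\<lambda>y. w y * (indicator ?E y *\<^sub>R K (x - y)))"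
    by (intro Bochner_Integration.integrable_bound[OF wi' m] AE_I2)
  then show ?thesis
    by (simp add: set_integrable_def mult_ac)
qed

section \<open>The principal value at a point of regularity\<close>

text \<open>Averaging the integrand over \<open>h\<close> and \<open>- h\<close> cancels the
  first-order singularity and leaves a second difference, dominated near the origin by an integrable
  power; dominated convergence then gives the limit. Convergence has to be shown because
  \<open>Lim\<close> carries information only when a limit exists. The second claim says that the
  inner ball lowers the value by at most the integral of the dominating function.\<close>

lemma L_op_tendsto:
  fixes K v :: "'a::euclidean_space \<Rightarrow> real"
  assumes K: "kernel_class_L0 \<gamma> lam Lam K" and \<gamma>: "0 < \<gamma>" "\<gamma> < 1" and lam: "0 < lam" "lam \<le> Lam"
    and v: "v \<in> L1_weighted \<gamma>"
    and s: "2 * \<gamma> < s" "s \<le> real DIM('a) + 2 * \<gamma>"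
    and \<rho>: "0 < \<rho>" and D: "0 \<le> D"
    and diff: "\<And>h. norm h \<le> \<rho> \<Longrightarrow> \<bar>v (x + h) + v (x - h) - 2 * v x\<bar> \<le> D * norm h powr s"
    and B: "0 \<le> B" "(\<integral>\<^sup>+(z::'a). ennreal (norm z powr - (real DIM('a) + 2 * \<gamma> - s)) * indicator (cball 0 \<rho>) z \<partial>lborel)
      \<le> ennreal B"
  obtains l where "((\<lambda>r. LINT y : {y. r < norm (x - y)} | lebesgue. (v x - v y) * K (x - y)) \<longlongrightarrow> l) (at_right 0)"
    "(LINT y : {y. \<rho> < norm (x - y)} | lebesgue. (v x - v y) * K (x - y)) - D * (Lam * c_const DIM('a) \<gamma>) * B \<le> l"
proof -
  define A where "A = Lam * c_const DIM('a) \<gamma>"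
  define q where "q = real DIM('a) + 2 * \<gamma> - s"
  have A: "0 \<le> A" using c_const_pos[OF \<gamma>, of "DIM('a)"] lam by (simp add: A_def)
  have Km: "K \<in> borel_measurable lebesgue" using K by (simp add: kernel_class_L0_def)
  have vm: "v \<in> borel_measurable lebesgue" using v by (simp add: L1_weighted_def)
  have Keven: "K (- z) = K z" for z
    using K unfolding kernel_class_L0_def by (metis minus_zero)
  define f where "f y = (v x - v y) * K (x - y)" for y
  \<comment> \<open>The mean of \<open>f (x + h)\<close> and \<open>f (x - h)\<close>, as
    \<open>K\<close> is even.\<close>
  define S where "S h = (2 * v x - v (x + h) - v (x - h)) * K h / 2" for h
  have tm: "(\<lambda>h. v (x + h)) \<in> borel_measurable lebesgue" "(\<lambda>h. v (x - h)) \<in> borel_measurable lebesgue"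
    by (rule measurable_compose[OF measurable_lebesgue_isometry vm]; simp add: dist_reflect surj_reflect)+
  have Sm: "S \<in> borel_measurable lebesgue"
    unfolding S_def using tm Km by measurable
  have Sle: "\<bar>S h\<bar> \<le> D * A * norm h powr - q" if "0 < norm h" "norm h \<le> \<rho>" for h
  proof -
    have "S h = - ((v (x + h) + v (x - h) - 2 * v x) * K h / 2)"
      unfolding S_def by (simp add: field_simps)
    then have "\<bar>S h\<bar> \<le> \<bar>v (x + h) + v (x - h) - 2 * v x\<bar> * \<bar>K h\<bar>"
      by (simp add: abs_mult)
    also have "\<dots> \<le> (D * norm h powr s) * (A * norm h powr - (real DIM('a) + 2 * \<gamma>))"
      using diff[OF that(2)] kernel_class_upper[OF K \<gamma> lam(1), of h] that A D
      by (intro mult_mono) (auto simp: A_def)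
    also have "\<dots> = D * A * norm h powr - q"
    proof -
      have "norm h powr s * norm h powr - (real DIM('a) + 2 * \<gamma>) = norm h powr - q"
        unfolding powr_add[symmetric] by (rule arg_cong[where f="\<lambda>t. norm h powr t"]) (simp add: q_def)
      then show ?thesis by (simp only: mult_ac)
    qed
    finally show ?thesis .
  qed
  define W where "W h = indicator (cball 0 \<rho>) h *\<^sub>R (D * A * norm h powr - q)" for h :: 'a
  have Wint: "integrable lebesgue W" and Wle: "(LINT h|lebesgue. W h) \<le> D * A * B"
  proof -
    have Wm: "W \<in> borel_measurable borel" unfolding W_def
      by (intro borel_measurable_scaleR borel_measurable_indicator) auto
    have W0: "0 \<le> W h" for h unfolding W_def using D A by (simp add: indicator_def)
    have "(\<integral>\<^sup>+h. ennreal (W h) \<partial>lebesgue) = (\<integral>\<^sup>+h. ennreal (W h) \<partial>lborel)"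
      by (rule nn_integral_completion)
    also have "\<dots> = (\<integral>\<^sup>+(h::'a). ennreal (D * A) * (ennreal (norm h powr - q) * indicator (cball 0 \<rho>) h) \<partial>lborel)"
      using D A by (intro nn_integral_cong) (simp add: W_def indicator_def ennreal_mult)
    also have "\<dots> = ennreal (D * A) * (\<integral>\<^sup>+(h::'a). ennreal (norm h powr - q) * indicator (cball 0 \<rho>) h \<partial>lborel)"
      by (intro nn_integral_cmult borel_measurable_times_ennreal borel_measurable_indicator) auto
    also have "\<dots> \<le> ennreal (D * A) * ennreal B"
      using B(2) by (intro mult_left_mono) (auto simp: q_def)
    also have "\<dots> = ennreal (D * A * B)" using D A B by (simp add: ennreal_mult)
    finally have le: "(\<integral>\<^sup>+h. ennreal (W h) \<partial>lebesgue) \<le> ennreal (D * A * B)" .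
    then have "(\<integral>\<^sup>+h. ennreal (norm (W h)) \<partial>lebesgue) < \<infinity>"
      using W0 by (simp add: le_less_trans)
    then show int: "integrable lebesgue W"
      by (intro integrableI_bounded measurable_completion) (use Wm in auto)
    have "ennreal (LINT h|lebesgue. W h) \<le> ennreal (D * A * B)"
      using le nn_integral_eq_integral[OF int] W0 by simp
    then show "(LINT h|lebesgue. W h) \<le> D * A * B"
      using D A B by (subst (asm) ennreal_le_iff) auto
  qed
  have fint: "set_integrable lebesgue {y. r < norm (x - y)} f" if "0 < r" for r
  proof -
    have "set_integrable lebesgue {y. r < norm (x - y)} (\<lambda>y. v x * K (x - y) - v y * K (x - y))"
      by (intro set_integral_diff(1) set_integrable_mult_right
          set_integrable_kernel_outside_ball_at[OF K \<gamma> lam(1) that]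
          set_integrable_weighted_kernel_outside_ball[OF K \<gamma> lam(1) that v])
    then show ?thesis by (simp add: f_def[abs_def] left_diff_distrib)
  qed
  define R where "R r = {h :: 'a. r < norm h \<and> norm h \<le> \<rho>}" for r
  have Rb: "R r \<in> sets borel" for r unfolding R_def by measurable
  have Sint: "integrable lebesgue (\<lambda>h. indicator (R r) h *\<^sub>R S h)" if "0 \<le> r" for r
  proof (rule Bochner_Integration.integrable_bound[OF Wint])
    show "(\<lambda>h. indicator (R r) h *\<^sub>R S h) \<in> borel_measurable lebesgue"
      using Rb[of r] Sm by (intro borel_measurable_scaleR borel_measurable_indicator) auto
    show "AE h in lebesgue. norm (indicator (R r) h *\<^sub>R S h) \<le> norm (W h)"
    proof (rule AE_I2)
      show "norm (indicator (R r) h *\<^sub>R S h) \<le> norm (W h)" for h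
      proof (cases "h \<in> R r")
        case True
        then have "0 < norm h" "norm h \<le> \<rho>" using that by (auto simp: R_def)
        from Sle[OF this] this(2) True show ?thesis by (simp add: W_def)
      qed simp
    qed
  qed
  have ann: "(LINT y:{y. r < norm (x - y)}|lebesgue. f y)
      = (LINT h|lebesgue. indicator (R r) h *\<^sub>R S h) + (LINT y:{y. \<rho> < norm (x - y)}|lebesgue. f y)"
    if r: "0 < r" "r < \<rho>" for r
  proof -
    let ?R = "{y. r < norm (x - y) \<and> norm (x - y) \<le> \<rho>}"
    have split: "{y. r < norm (x - y)} = ?R \<union> {y. \<rho> < norm (x - y)}" using r by auto
    have m: "?R \<in> sets lebesgue"
    proof -
      have "?R \<in> sets borel" by measurable
      then show ?thesis by simp
    qed
    have i1: "set_integrable lebesgue ?R f"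
      by (rule set_integrable_subset[OF fint[OF r(1)] m]) auto
    have "(LINT y:{y. r < norm (x - y)}|lebesgue. f y)
        = (LINT y:?R|lebesgue. f y) + (LINT y:{y. \<rho> < norm (x - y)}|lebesgue. f y)"
      unfolding split by (rule set_integral_Un[OF _ i1 fint[OF \<rho>]]) auto
    \<comment> \<open>The annulus is parametrised both by \<open>x - h\<close> and by
      \<open>x + h\<close>, and the two integrals are averaged.\<close>
    moreover have "(LINT y:?R|lebesgue. f y) = (LINT h|lebesgue. indicator (R r) h *\<^sub>R S h)"
    proof -
      have int: "integrable lebesgue (\<lambda>y. indicator ?R y *\<^sub>R f y)"
        using i1 by (simp add: set_integrable_def)
      have ind: "indicator ?R (x - h) = (indicator (R r) h :: real)"
        "indicator ?R (x + h) = (indicator (R r) h :: real)" for h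
        by (simp_all add: indicator_def R_def)
      let ?f1 = "\<lambda>h. indicator ?R (x - h) *\<^sub>R f (x - h)" and ?f2 = "\<lambda>h. indicator ?R (x + h) *\<^sub>R f (x + h)"
      have e1: "(LINT h|lebesgue. ?f1 h) = (LINT y:?R|lebesgue. f y)"
        unfolding set_lebesgue_integral_def
        by (rule integral_lebesgue_isometry[OF dist_reflect surj_reflect borel_measurable_integrable[OF int]])
      have e2: "(LINT h|lebesgue. ?f2 h) = (LINT y:?R|lebesgue. f y)"
        unfolding set_lebesgue_integral_def
        by (rule integral_lebesgue_isometry[OF dist_translate surj_translate borel_measurable_integrable[OF int]])
      have i1: "integrable lebesgue ?f1"
        by (rule integrable_lebesgue_isometry[OF dist_reflect surj_reflect int])
      have i2: "integrable lebesgue ?f2"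
        by (rule integrable_lebesgue_isometry[OF dist_translate surj_translate int])
      have "(LINT h|lebesgue. indicator (R r) h *\<^sub>R S h) = (LINT h|lebesgue. (?f1 h + ?f2 h) / 2)"
      proof (intro Bochner_Integration.integral_cong refl)
        show "indicator (R r) h *\<^sub>R S h = (?f1 h + ?f2 h) / 2" for h
          unfolding ind f_def S_def by (simp add: Keven field_simps)
      qed
      also have "\<dots> = ((LINT h|lebesgue. ?f1 h) + (LINT h|lebesgue. ?f2 h)) / 2"
        using Bochner_Integration.integral_add[OF i1 i2] by simp
      finally show ?thesis by (simp only: e1 e2) simp
    qed
    ultimately show ?thesis by simp
  qed
  define l where "l = (LINT h|lebesgue. indicator (R 0) h *\<^sub>R S h) + (LINT y:{y. \<rho> < norm (x - y)}|lebesgue. f y)"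
  have "((\<lambda>r. LINT y:{y. r < norm (x - y)}|lebesgue. f y) \<longlongrightarrow> l) (at_right 0)"
  proof (rule tendsto_at_right_sequentially[OF \<rho>])
    fix X :: "nat \<Rightarrow> real"
    assume X: "\<And>n. 0 < X n" "\<And>n. X n < \<rho>" "X \<longlonglongrightarrow> 0"
    have "(\<lambda>n. LINT h|lebesgue. indicator (R (X n)) h *\<^sub>R S h) \<longlonglongrightarrow> (LINT h|lebesgue. indicator (R 0) h *\<^sub>R S h)"
    proof (rule integral_dominated_convergence[where w=W])
      show "AE h in lebesgue. (\<lambda>n. indicator (R (X n)) h *\<^sub>R S h) \<longlonglongrightarrow> indicator (R 0) h *\<^sub>R S h"
      proof (rule AE_I2)
        fix h :: 'a
        have "\<forall>\<^sub>F n in sequentially. (indicator (R (X n)) h :: real) = indicator (R 0) h"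
        proof (cases "0 < norm h")
          case True
          have "\<forall>\<^sub>F n in sequentially. X n < norm h"
            using order_tendstoD(2)[OF X(3) True] .
          then show ?thesis
            by (rule eventually_mono) (use True in \<open>auto simp: R_def indicator_def\<close>)
        next
          case False
          then have "(indicator (R (X n)) h :: real) = indicator (R 0) h" for n
            using X(1)[of n] by (auto simp: R_def indicator_def)
          then show ?thesis by simp
        qed
        then have "\<forall>\<^sub>F n in sequentially. indicator (R (X n)) h *\<^sub>R S h = indicator (R 0) h *\<^sub>R S h"
          by eventually_elim simp
        then show "(\<lambda>n. indicator (R (X n)) h *\<^sub>R S h) \<longlonglongrightarrow> indicator (R 0) h *\<^sub>R S h"
          by (rule tendsto_eventually)
      qed
      show "AE h in lebesgue. norm (indicator (R (X n)) h *\<^sub>R S h) \<le> W h" for n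
      proof (rule AE_I2)
        fix h :: 'a
        show "norm (indicator (R (X n)) h *\<^sub>R S h) \<le> W h"
        proof (cases "h \<in> R (X n)")
          case True
          then have h: "0 < norm h" "norm h \<le> \<rho>" using X(1)[of n] by (auto simp: R_def)
          from Sle[OF this] h(2) True show ?thesis by (simp add: W_def)
        qed (use D A in \<open>simp add: W_def\<close>)
      qed
    qed (use Wint Sint X(1) in \<open>auto intro!: borel_measurable_integrable simp: less_imp_le\<close>)
    then have "(\<lambda>n. (LINT h|lebesgue. indicator (R (X n)) h *\<^sub>R S h) + (LINT y:{y. \<rho> < norm (x - y)}|lebesgue. f y))
        \<longlonglongrightarrow> l"
      unfolding l_def by (intro tendsto_add tendsto_const)
    then show "(\<lambda>n. LINT y:{y. X n < norm (x - y)}|lebesgue. f y) \<longlonglongrightarrow> l"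
      using ann X by simp
  qed
  moreover have "(LINT y:{y. \<rho> < norm (x - y)}|lebesgue. f y) - D * A * B \<le> l"
  proof -
    have "\<bar>LINT h|lebesgue. indicator (R 0) h *\<^sub>R S h\<bar> \<le> (LINT h|lebesgue. W h)"
    proof (rule integral_abs_bound_integral[OF Sint Wint])
      fix h :: 'a
      show "\<bar>indicator (R 0) h *\<^sub>R S h\<bar> \<le> W h"
      proof (cases "h \<in> R 0")
        case True
        then have h: "0 < norm h" "norm h \<le> \<rho>" by (auto simp: R_def)
        from Sle[OF this] h(2) True show ?thesis by (simp add: W_def)
      qed (use D A in \<open>simp add: W_def\<close>)
    qed simp
    with Wle show ?thesis unfolding l_def by linarith
  qed
  ultimately show ?thesis
    using that unfolding f_def A_def by blast
qed

section \<open>Orbits, tubes and the reflected cone\<close>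

text \<open>The points at distance at most \<open>\<rho>\<close> from the \<open>O(m)\<^sup>2\<close>-orbit of \<open>x\<close>.\<close>

definition tube :: "('m::finite) dbl \<Rightarrow> real \<Rightarrow> 'm dbl set" where
  "tube x \<rho> = {y. (norm (fst y) - norm (fst x))\<^sup>2 + (norm (snd y) - norm (snd x))\<^sup>2 \<le> \<rho>\<^sup>2}"

text \<open>The reverse triangle inequality in each factor. Thus points off the tube lie in the
  domain of the truncated integral.\<close>

lemma cball_subset_tube:
  fixes x y :: "('m::finite) dbl"
  assumes "0 \<le> \<rho>" "norm (x - y) \<le> \<rho>"
  shows "y \<in> tube x \<rho>"
proof -
  have sq: "(norm b - norm a)\<^sup>2 \<le> (norm (a - b))\<^sup>2" for a b :: "real^'m"
    using norm_triangle_ineq3[of b a] by (simp add: abs_le_square_iff[symmetric] norm_minus_commute)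
  have "(norm (fst y) - norm (fst x))\<^sup>2 + (norm (snd y) - norm (snd x))\<^sup>2
      \<le> (norm (fst x - fst y))\<^sup>2 + (norm (snd x - snd y))\<^sup>2"
    by (intro add_mono sq)
  also have "\<dots> = (norm (x - y))\<^sup>2" by (simp add: norm_prod_def)
  also have "\<dots> \<le> \<rho>\<^sup>2" using assms by (intro power_mono) auto
  finally show ?thesis by (simp add: tube_def)
qed

text \<open>Rescaling along the ray of \<open>a\<close> turns the reverse triangle inequality into
  an equality; for \<open>a = 0\<close> any direction serves.\<close>

lemma exists_same_direction:
  fixes a :: "'a::euclidean_space"
  assumes "0 \<le> t"
  obtains b where "norm b = t" "norm (b - a) = \<bar>t - norm a\<bar>"
proof (cases "a = 0")
  case True
  obtain b :: 'a where "norm b = t" using vector_choose_size[OF assms] .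
  with True show ?thesis using that assms by simp
next
  case False
  have "norm ((t / norm a) *\<^sub>R a - a) = \<bar>t - norm a\<bar>"
  proof -
    have "(t / norm a) *\<^sub>R a - a = ((t - norm a) / norm a) *\<^sub>R a"
      using False by (simp add: diff_divide_distrib scaleR_left_diff_distrib)
    then show ?thesis using False by simp
  qed
  then show ?thesis using that[of "(t / norm a) *\<^sub>R a"] False assms by simp
qed

text \<open>Each component of \<open>y\<close> is turned towards the corresponding component of
  \<open>x\<close>. This lets continuity at one point control a doubly radial function on the whole
  tube.\<close>

lemma tube_representative:
  fixes x y :: "('m::finite) dbl"
  assumes "0 \<le> \<rho>" "y \<in> tube x \<rho>"
  obtains z where "norm (fst z) = norm (fst y)" "norm (snd z) = norm (snd y)" "dist x z \<le> \<rho>"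
proof -
  obtain a where a: "norm a = norm (fst y)" "norm (a - fst x) = \<bar>norm (fst y) - norm (fst x)\<bar>"
    using exists_same_direction[OF norm_ge_zero] by blast
  obtain b where b: "norm b = norm (snd y)" "norm (b - snd x) = \<bar>norm (snd y) - norm (snd x)\<bar>"
    using exists_same_direction[OF norm_ge_zero] by blast
  have "(dist x (a, b))\<^sup>2 = (norm (a - fst x))\<^sup>2 + (norm (b - snd x))\<^sup>2"
    by (simp add: dist_prod_def dist_norm norm_minus_commute)
  also have "\<dots> \<le> \<rho>\<^sup>2" using assms(2) by (simp add: a b tube_def)
  finally have "dist x (a, b) \<le> \<rho>" using assms(1) by (rule power2_le_imp_le)
  then show ?thesis using that[of "(a, b)"] a b by simp
qed

lemma open_cone_O: "open (cone_O :: ('m::finite) dbl set)"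
  unfolding cone_O_def by (intro open_Collect_less continuous_intros)

lemma open_cone_reflected: "open {y :: ('m::finite) dbl. norm (fst y) < norm (snd y)}"
  by (intro open_Collect_less continuous_intros)

lemma closed_tube: "closed (tube x \<rho>)"
  unfolding tube_def by (intro closed_Collect_le continuous_intros)

text \<open>The reflected cone contains a ball of radius \<epsilon> all of whose points are within 4
  \<epsilon> of \<open>x\<close>. The lower kernel bound there times the volume of the ball scales
  like \<open>\<epsilon> powr - (2 * \<gamma>)\<close>.\<close>

lemma set_integral_reflected_cone_ge:
  fixes K :: "('m::finite) dbl \<Rightarrow> real"
  assumes K: "kernel_class_L0 \<gamma> lam Lam K" and \<gamma>: "0 < \<gamma>" "\<gamma> < 1" and lam: "0 < lam"
    and \<epsilon>: "0 < \<epsilon>" and x: "norm (snd x) < norm (fst x)" "norm (fst x) < norm (snd x) + \<epsilon>"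
    and int: "set_integrable lebesgue {y. norm (fst y) < norm (snd y)} (\<lambda>y. K (x - y))"
  shows "lam * c_const DIM('m dbl) \<gamma> * unit_ball_vol (real DIM('m dbl))
      * 4 powr - (real DIM('m dbl) + 2 * \<gamma>) * \<epsilon> powr - (2 * \<gamma>)
    \<le> (LINT y:{y. norm (fst y) < norm (snd y)}|lebesgue. K (x - y))"
proof -
  define n where "n = DIM('m dbl)"
  define p where "p = real n + 2 * \<gamma>"
  have p: "0 < p" using \<gamma> by (simp add: p_def add_nonneg_pos)
  define a where "a = lam * c_const n \<gamma>"
  have "0 < n" unfolding n_def by (rule DIM_positive)
  then have a: "0 \<le> a" using c_const_pos[OF \<gamma>, of n] lam by (simp add: a_def)
  let ?S = "{y :: 'm dbl. norm (fst y) < norm (snd y)}"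
  \<comment> \<open>Of the 3 \<epsilon>, one covers the gap between \<open>norm (fst x)\<close> and
    \<open>norm (snd x)\<close>, and one each the variation of the two components within the
    ball.\<close>
  obtain b where b: "norm b = norm (snd x) + 3 * \<epsilon>" "norm (b - snd x) = 3 * \<epsilon>"
    using exists_same_direction[of "norm (snd x) + 3 * \<epsilon>" "snd x"] \<epsilon> by auto
  define y0 where "y0 = (fst x, b)"
  have d0: "dist x y0 = 3 * \<epsilon>"
  proof -
    have "dist x y0 = norm (b - snd x)"
      by (simp add: y0_def dist_prod_def dist_norm norm_minus_commute)
    then show ?thesis using b(2) by simp
  qed
  have sub: "y \<in> ?S" and near: "norm (x - y) \<le> 4 * \<epsilon>" if y: "y \<in> ball y0 \<epsilon>" for y
  proof -
    have d: "dist y0 y < \<epsilon>" using y by simp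
    have "norm (fst y) < norm (fst x) + \<epsilon>"
      using dist_fst_le[of y0 y] d norm_triangle_ineq2[of "fst y" "fst x"]
      by (simp add: y0_def dist_norm norm_minus_commute)
    moreover have "norm b - \<epsilon> < norm (snd y)"
      using dist_snd_le[of y0 y] d norm_triangle_ineq2[of b "snd y"]
      by (simp add: y0_def dist_norm)
    ultimately show "y \<in> ?S" using b(1) x(2) by simp
    show "norm (x - y) \<le> 4 * \<epsilon>"
      using dist_triangle[of x y y0] d0 d by (simp add: dist_norm)
  qed
  have le: "indicator (ball y0 \<epsilon>) y *\<^sub>R (a * (4 * \<epsilon>) powr - p) \<le> indicator ?S y *\<^sub>R K (x - y)" for y
  proof (cases "y \<in> ball y0 \<epsilon>")
    case True
    have ne: "x - y \<noteq> 0" using sub[OF True] x(1) by auto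
    have "(4 * \<epsilon>) powr - p \<le> norm (x - y) powr - p"
      using near[OF True] ne p by (intro powr_mono2') auto
    then have "a * (4 * \<epsilon>) powr - p \<le> a * norm (x - y) powr - p"
      using a by (rule mult_left_mono)
    also have "\<dots> \<le> K (x - y)"
      unfolding a_def p_def n_def by (rule kernel_class_lower[OF K \<gamma> lam ne])
    finally show ?thesis using True sub[OF True] by simp
  next
    case False
    have "0 \<le> K (x - y)" if "y \<in> ?S"
    proof -
      have "x \<noteq> y" using that x(1) by auto
      then show ?thesis by (intro kernel_class_nonneg[OF K \<gamma> lam]) simp
    qed
    then show ?thesis using False by (auto simp: indicator_def)
  qed
  have fin: "emeasure lebesgue (ball y0 \<epsilon>) < \<infinity>"
    using \<epsilon> by (simp add: emeasure_ball)
  have "(LINT y|lebesgue. indicator (ball y0 \<epsilon>) y *\<^sub>R (a * (4 * \<epsilon>) powr - p))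
      \<le> (LINT y|lebesgue. indicator ?S y *\<^sub>R K (x - y))"
  proof (rule integral_mono[OF _ _ le])
    show "integrable lebesgue (\<lambda>y. indicator (ball y0 \<epsilon>) y *\<^sub>R (a * (4 * \<epsilon>) powr - p))"
      using fin by (intro integrable_scaleR_left integrable_real_indicator) auto
    show "integrable lebesgue (\<lambda>y. indicator ?S y *\<^sub>R K (x - y))"
      using int by (simp add: set_integrable_def)
  qed
  also have "(LINT y|lebesgue. indicator (ball y0 \<epsilon>) y *\<^sub>R (a * (4 * \<epsilon>) powr - p))
      = measure lebesgue (ball y0 \<epsilon>) * (a * (4 * \<epsilon>) powr - p)"
    using fin by simp
  also have "\<dots> = a * unit_ball_vol n * 4 powr - p * (\<epsilon> powr - p * \<epsilon> ^ n)"
    using \<epsilon> content_ball[of \<epsilon> y0] by (simp add: n_def powr_mult)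
  also have "\<epsilon> powr - p * \<epsilon> ^ n = \<epsilon> powr - (2 * \<gamma>)"
    using powr_minus_mult_power[OF \<epsilon>, of p n] by (simp add: p_def)
  finally show ?thesis
    by (simp add: set_lebesgue_integral_def a_def n_def p_def)
qed

text \<open>By oddness \<open>M - v y = 2 M - (M - v (star y))\<close> on the reflected cone. The term \<open>2 M\<close> contributes
  \<open>2 M J\<close>; the rest is absorbed, away from the orbit of \<open>x\<close>, by the integral of \<open>M - v\<close> over the
  cone (positivity condition), and near the orbit it is at most \<open>\<omega> J\<close>.\<close>

lemma outer_integral_ge:
  fixes K v :: "('m::finite) dbl \<Rightarrow> real"
  assumes K: "kernel_class_L0 \<gamma> lam Lam K" and \<gamma>: "0 < \<gamma>" "\<gamma> < 1" and lam: "0 < lam"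
    and \<mu>: "normalized_Haar_O2 \<mu>" and Krad: "radially_symmetric K" and pos: "positivity_condition \<mu> K"
    and v: "v \<in> L1_weighted \<gamma>" "doubly_radial v" "\<And>y. - v (star y) = v y"
    and \<rho>: "0 < \<rho>" "cball x \<rho> \<subseteq> cone_O"
    and M: "0 \<le> M" "\<And>y. y \<in> cone_O \<Longrightarrow> v y \<le> M"
    and \<omega>: "\<And>y. y \<in> tube x \<rho> \<Longrightarrow> M - v y \<le> \<omega>"
  shows set_integrable_reflected_cone: "set_integrable lebesgue {y. norm (fst y) < norm (snd y)} (\<lambda>y. K (x - y))"
    and "(2 * M - \<omega>) * (LINT y:{y. norm (fst y) < norm (snd y)}|lebesgue. K (x - y))
        - (M - v x) * (LINT z:{z. \<rho> < norm z}|lebesgue. K z)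
      \<le> (LINT y:{y. \<rho> < norm (x - y)}|lebesgue. (v x - v y) * K (x - y))"
proof -
  define S where "S = {y :: 'm dbl. norm (fst y) < norm (snd y)}"
  define E where "E = {y. \<rho> < norm (x - y)}"
  define u where "u y = M - v y" for y
  have x: "x \<in> cone_O" using \<rho> by auto
  have \<omega>0: "0 \<le> \<omega>"
    using \<omega>[of x] M(2)[OF x] \<rho>(1) cball_subset_tube[of \<rho> x x] by simp
  have SO: "y \<in> S \<longleftrightarrow> star y \<in> cone_O" for y by (simp add: S_def star_def cone_O_def)
  have disj: "y \<notin> cone_O" if "y \<in> S" for y using that by (simp add: S_def cone_O_def)
  have nE: "y \<in> E" if "y \<notin> cone_O" for y
    using \<rho>(2) that by (force simp: E_def dist_norm subset_eq)
  have SE: "y \<in> E" if "y \<in> S" for y using nE disj that by blast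
  then have SE': "S \<subseteq> E" by blast
  have Eb: "E \<in> sets borel"
    unfolding E_def by (intro borel_open open_Collect_less continuous_intros)
  have Sb: "S \<in> sets borel" unfolding S_def by (intro borel_open open_cone_reflected)
  have Ob: "(cone_O :: 'm dbl set) \<in> sets borel" by (intro borel_open open_cone_O)
  have Tb: "tube x \<rho> \<in> sets borel" by (intro borel_closed closed_tube)
  note mb = Eb Sb Ob Tb
  have Km: "K \<in> borel_measurable lebesgue" using K by (simp add: kernel_class_L0_def)
  have vm: "v \<in> borel_measurable lebesgue" using v(1) by (simp add: L1_weighted_def)
  have um: "u \<in> borel_measurable lebesgue" unfolding u_def using vm by measurable
  have Kxm: "(\<lambda>y. K (x - y)) \<in> borel_measurable lebesgue"
    by (rule measurable_compose[OF measurable_lebesgue_isometry[OF dist_reflect surj_reflect] Km])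
  have K0: "0 \<le> K (x - y)" if "y \<in> E" for y
  proof -
    have "x - y \<noteq> 0" using that \<rho>(1) by (auto simp: E_def)
    then show ?thesis by (rule kernel_class_nonneg[OF K \<gamma> lam])
  qed
  have u0: "0 \<le> u y" if "y \<in> cone_O" for y using M(2)[OF that] by (simp add: u_def)
  have iK: "set_integrable lebesgue E (\<lambda>y. K (x - y))"
    unfolding E_def by (rule set_integrable_kernel_outside_ball_at[OF K \<gamma> lam \<rho>(1)])
  have iv: "set_integrable lebesgue E (\<lambda>y. v y * K (x - y))"
    unfolding E_def by (rule set_integrable_weighted_kernel_outside_ball[OF K \<gamma> lam \<rho>(1) v(1)])
  have iu: "set_integrable lebesgue E (\<lambda>y. u y * K (x - y))"
  proof -
    have "set_integrable lebesgue E (\<lambda>y. M * K (x - y))"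
      by (intro set_integrable_mult_right iK)
    from set_integral_diff(1)[OF this iv] show ?thesis
      by (simp add: u_def left_diff_distrib)
  qed
  show iKS: "set_integrable lebesgue {y. norm (fst y) < norm (snd y)} (\<lambda>y. K (x - y))"
    using set_integrable_subset[OF iK, of S] Sb SE' by (simp add: S_def)
  have iuS: "set_integrable lebesgue S (\<lambda>y. u y * K (x - y))"
    using set_integrable_subset[OF iu, of S] Sb SE' by simp
  have iuO: "set_integrable lebesgue (cone_O \<inter> E) (\<lambda>y. u y * K (x - y))"
    using set_integrable_subset[OF iu, of "cone_O \<inter> E"] Ob Eb by auto
  define J where "J = (LINT y:S|lebesgue. K (x - y))"
  define T where "T = (LINT z:{z. \<rho> < norm z}|lebesgue. K z)"
  define GO where "GO y = indicator (cone_O \<inter> E) y *\<^sub>R (u y * K (x - y))" for y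
  define GS where "GS y = indicator S y *\<^sub>R (u y * K (x - y))" for y
  \<comment> \<open>By oddness \<open>u (star y) = 2 * M - u y\<close>, so \<open>GS\<close> can be
    traded for \<open>2 * M\<close> times the kernel minus \<open>Q\<close>.\<close>
  define Q where "Q y = indicator S y *\<^sub>R (u (star y) * K (x - y))" for y
  have iGO: "integrable lebesgue GO" and iGS: "integrable lebesgue GS"
    using iuO iuS by (simp_all add: GO_def[abs_def] GS_def[abs_def] set_integrable_def)
  have iK': "integrable lebesgue (\<lambda>y. indicator S y *\<^sub>R K (x - y))"
    using iKS by (simp add: set_integrable_def S_def)
  have QGS: "Q y = 2 * M * (indicator S y *\<^sub>R K (x - y)) - GS y" for y
  proof -
    have "v (star y) = - v y" using v(3)[of y] by simp
    then show ?thesis by (simp add: Q_def GS_def u_def algebra_simps)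
  qed
  have iQ: "integrable lebesgue Q"
    unfolding QGS[abs_def] using iK' iGS by (intro Bochner_Integration.integrable_diff integrable_mult_right)
  have intQ: "(LINT y|lebesgue. Q y) = 2 * M * J - (LINT y|lebesgue. GS y)"
    unfolding QGS using iK' iGS
    by (subst Bochner_Integration.integral_diff) (simp_all add: J_def set_lebesgue_integral_def)
  \<comment> \<open>Only the interface of the two cones is dropped. There \<open>v\<close> is both
    even and odd under \<open>star\<close>, hence 0, and the lost integrand
    \<open>M * K (x - y)\<close> is nonnegative.\<close>
  have "GO y + GS y \<le> indicator E y *\<^sub>R (u y * K (x - y))" for y
  proof -
    consider "y \<in> cone_O" | "y \<in> S" | "norm (fst y) = norm (snd y)"
      by (fastforce simp: cone_O_def S_def)
    then show ?thesis
    proof cases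
      case 1
      then have "y \<notin> S" using disj by blast
      with 1 show ?thesis by (simp add: GO_def GS_def indicator_def)
    next
      case 2
      then show ?thesis using disj SE by (simp add: GO_def GS_def)
    next
      case 3
      have "v (star y) = v y"
        by (rule v(2)[unfolded doubly_radial_def, rule_format]) (simp_all add: star_def 3)
      then have "v y = 0" using v(3)[of y] by simp
      moreover have "y \<notin> cone_O" "y \<notin> S" using 3 by (auto simp: cone_O_def S_def)
      ultimately show ?thesis using K0[OF nE] M(1) by (simp add: GO_def GS_def u_def indicator_def)
    qed
  qed
  then have "(LINT y|lebesgue. GO y + GS y) \<le> (LINT y:E|lebesgue. u y * K (x - y))"
    unfolding set_lebesgue_integral_def using iGO iGS iu
    by (intro integral_mono) (auto simp: set_integrable_def)
  then have 1: "(LINT y|lebesgue. GO y) + (LINT y|lebesgue. GS y) \<le> (LINT y:E|lebesgue. u y * K (x - y))"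
    using iGO iGS by simp
  \<comment> \<open>Here \<open>v x - v y\<close> is \<open>u y\<close> minus the defect
    \<open>M - v x\<close>. The factor \<open>T\<close> does not depend on \<open>x\<close>, which
    later allows choosing \<open>x\<close> after \<rho>.\<close>
  have 2: "(LINT y:E|lebesgue. (v x - v y) * K (x - y)) = (LINT y:E|lebesgue. u y * K (x - y)) - (M - v x) * T"
  proof -
    have T: "T = (LINT y:E|lebesgue. K (x - y))"
      unfolding T_def E_def by (rule set_integral_kernel_outside_ball_at[OF K \<gamma> lam \<rho>(1), symmetric])
    have "(LINT y:E|lebesgue. (v x - v y) * K (x - y)) = (LINT y:E|lebesgue. u y * K (x - y) - (M - v x) * K (x - y))"
      by (simp add: u_def algebra_simps)
    also have "\<dots> = (LINT y:E|lebesgue. u y * K (x - y)) - (LINT y:E|lebesgue. (M - v x) * K (x - y))"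
      by (intro set_integral_diff(2) iu set_integrable_mult_right iK)
    finally show ?thesis by (simp add: T)
  qed
  \<comment> \<open>Removing the tube rather than the ball keeps \<open>g\<close> doubly radial, as
    the kernel comparison demands.\<close>
  define g where "g y = indicator (cone_O - tube x \<rho>) y * ennreal (u y)" for y
  have gm: "g \<in> borel_measurable lebesgue"
    unfolding g_def[abs_def] using um mb
    by (intro borel_measurable_times_ennreal borel_measurable_indicator) auto
  have grad: "g y = g z" if "norm (fst y) = norm (fst z)" "norm (snd y) = norm (snd z)" for y z
  proof -
    have "v y = v z" using v(2) that unfolding doubly_radial_def by blast
    then show ?thesis using that by (simp add: g_def u_def tube_def cone_O_def indicator_def)
  qed
  have J0: "0 \<le> J"
    unfolding J_def set_lebesgue_integral_def using K0 SE by (intro integral_nonneg_AE AE_I2) (simp add: indicator_def)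
  have GO0: "0 \<le> GO y" for y using K0 u0 by (simp add: GO_def indicator_def)
  have "(LINT y|lebesgue. Q y) \<le> \<omega> * J + (LINT y|lebesgue. GO y)"
  proof -
    have Q0: "0 \<le> Q y" for y using K0[OF SE] u0 SO by (simp add: Q_def indicator_def)
    have Qm: "(\<lambda>y. ennreal (Q y)) \<in> borel_measurable lebesgue"
      using borel_measurable_integrable[OF iQ] by measurable
    let ?k = "\<lambda>y. ennreal (indicator S y *\<^sub>R K (x - y))"
    have km: "?k \<in> borel_measurable lebesgue"
      using borel_measurable_integrable[OF iK'] by measurable
    have "ennreal (LINT y|lebesgue. Q y) = (\<integral>\<^sup>+y. ennreal (Q y) \<partial>lebesgue)"
      by (rule nn_integral_eq_integral[OF iQ, symmetric]) (simp add: Q0)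
    also have "\<dots> = (\<integral>\<^sup>+z. ennreal (Q (star z)) \<partial>lebesgue)"
      by (rule nn_integral_lebesgue_isometry[OF dist_star surj_star Qm, symmetric])
    \<comment> \<open>On the tube \<open>u\<close> is replaced by its bound \<omega>; off the tube
      it is kept as \<open>g\<close>.\<close>
    also have "\<dots> \<le> (\<integral>\<^sup>+z. ennreal \<omega> * ?k (star z) + g z * ennreal (K (x - star z)) \<partial>lebesgue)"
    proof (rule nn_integral_mono)
      fix z :: "'m dbl"
      show "ennreal (Q (star z)) \<le> ennreal \<omega> * ?k (star z) + g z * ennreal (K (x - star z))"
      proof (cases "z \<in> cone_O")
        case True
        then have s: "star z \<in> S" by (simp add: SO star_star)
        note k0 = K0[OF SE[OF s]]
        show ?thesis
        proof (cases "z \<in> tube x \<rho>")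
          case True
          have "u z * K (x - star z) \<le> \<omega> * K (x - star z)"
            using \<omega>[OF True] k0 by (intro mult_right_mono) (auto simp: u_def)
          then show ?thesis
            using s True \<omega>0 k0 by (simp add: Q_def star_star g_def ennreal_mult[symmetric] ennreal_leI)
        next
          case False
          then show ?thesis
            using s True u0[OF True] k0 by (simp add: Q_def star_star g_def ennreal_mult add_increasing)
        qed
      next
        case False
        then have "star z \<notin> S" by (simp add: SO star_star)
        then show ?thesis by (simp add: Q_def)
      qed
    qed
    also have "\<dots> = ennreal \<omega> * (\<integral>\<^sup>+z. ?k (star z) \<partial>lebesgue) + (\<integral>\<^sup>+z. g z * ennreal (K (x - star z)) \<partial>lebesgue)"
    proof -
      have 1: "(\<lambda>z. ?k (star z)) \<in> borel_measurable lebesgue"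
        by (rule measurable_compose[OF measurable_lebesgue_isometry[OF dist_star surj_star] km])
      have 2: "(\<lambda>z. K (x - star z)) \<in> borel_measurable lebesgue"
        by (rule measurable_compose[OF measurable_lebesgue_isometry[OF dist_star surj_star] Kxm])
      show ?thesis
        using 1 2 gm by (subst nn_integral_add) (simp_all add: nn_integral_cmult)
    qed
    also have "(\<integral>\<^sup>+z. ?k (star z) \<partial>lebesgue) = (\<integral>\<^sup>+z. ?k z \<partial>lebesgue)"
      by (rule nn_integral_lebesgue_isometry[OF dist_star surj_star km])
    also have "(\<integral>\<^sup>+z. ?k z \<partial>lebesgue) = ennreal J"
      unfolding J_def set_lebesgue_integral_def using K0 SE
      by (intro nn_integral_eq_integral[OF iK'] AE_I2) (simp add: indicator_def)
    also have "(\<integral>\<^sup>+z. g z * ennreal (K (x - star z)) \<partial>lebesgue) \<le> (\<integral>\<^sup>+z. g z * ennreal (K (x - z)) \<partial>lebesgue)"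
      by (rule nn_integral_reflected_kernel_le[OF \<mu> gm grad _ Km Krad pos x]) (simp_all add: g_def)
    also have "\<dots> \<le> (\<integral>\<^sup>+z. ennreal (GO z) \<partial>lebesgue)"
    proof (rule nn_integral_mono)
      fix z :: "'m dbl"
      show "g z * ennreal (K (x - z)) \<le> ennreal (GO z)"
      proof (cases "z \<in> cone_O - tube x \<rho>")
        case True
        then have "z \<in> E" using cball_subset_tube[of \<rho> x z] \<rho>(1) by (force simp: E_def)
        then show ?thesis using True u0 K0 by (simp add: g_def GO_def ennreal_mult)
      qed (simp add: g_def)
    qed
    also have "\<dots> = ennreal (LINT y|lebesgue. GO y)"
      by (rule nn_integral_eq_integral[OF iGO]) (simp add: GO0)
    finally have "ennreal (LINT y|lebesgue. Q y) \<le> ennreal \<omega> * ennreal J + ennreal (LINT y|lebesgue. GO y)"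
      by (simp add: add_left_mono)
    also have "\<dots> = ennreal (\<omega> * J + (LINT y|lebesgue. GO y))"
      using \<omega>0 J0 GO0 by (simp add: ennreal_mult ennreal_plus)
    finally show ?thesis
      using \<omega>0 J0 GO0 by (subst (asm) ennreal_le_iff) auto
  qed
  \<comment> \<open>The integral of \<open>GO\<close> occurs with both signs and cancels.\<close>
  then show "(2 * M - \<omega>) * (LINT y:{y. norm (fst y) < norm (snd y)}|lebesgue. K (x - y))
        - (M - v x) * (LINT z:{z. \<rho> < norm z}|lebesgue. K z)
      \<le> (LINT y:{y. \<rho> < norm (x - y)}|lebesgue. (v x - v y) * K (x - y))"
    using 1 2 intQ by (simp add: left_diff_distrib J_def S_def E_def T_def)
qed

section \<open>The maximum principle\<close>

text \<open>The limsup condition confines large values on \<open>N\<close> to a bounded set, so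
  compactness of a truncated closure yields a maximum point. It is not on the interface of the
  cones, where \<open>v\<close> vanishes by symmetry, nor elsewhere in the cone outside
  \<open>N\<close>, where \<open>v\<close> is nonpositive.\<close>

lemma positive_maximum_attained:
  fixes v :: "('m::finite) dbl \<Rightarrow> real"
  assumes N: "N \<subseteq> cone_O" and cont: "continuous_on (closure N) v" and rad: "doubly_radial v"
    and nonpos: "\<And>x. x \<in> cone_O - N \<Longrightarrow> v x \<le> 0" and odd: "\<And>x. - v (star x) = v x"
    and lim: "Limsup (inf at_infinity (principal N)) (\<lambda>x. ereal (v x)) \<le> 0"
    and x1: "x1 \<in> N" "0 < v x1"
  obtains x0 where "x0 \<in> N" "0 < v x0" "\<And>y. y \<in> cone_O \<Longrightarrow> v y \<le> v x0"
proof -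
  have "Limsup (inf at_infinity (principal N)) (\<lambda>x. ereal (v x)) < ereal (v x1)"
    using lim x1(2) by (simp add: le_less_trans)
  then have "eventually (\<lambda>x. ereal (v x) < ereal (v x1)) (inf at_infinity (principal N))"
    by (rule Limsup_lessD)
  then obtain b where b: "\<And>x. b \<le> norm x \<Longrightarrow> x \<in> N \<Longrightarrow> v x < v x1"
    unfolding eventually_inf_principal eventually_at_infinity by auto
  let ?X = "closure N \<inter> cball 0 b"
  have "norm x1 < b" using b[of x1] x1(1) by force
  then have x1X: "x1 \<in> ?X" using x1(1) closure_subset[of N] by auto
  have "compact ?X" by (intro closed_Int_compact) auto
  moreover have "continuous_on ?X v" using cont by (rule continuous_on_subset) auto
  ultimately obtain x0 where x0: "x0 \<in> ?X" "\<And>y. y \<in> ?X \<Longrightarrow> v y \<le> v x0"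
    using continuous_attains_sup[of ?X v] x1X by blast
  have pos: "0 < v x0" using x0(2)[OF x1X] x1(2) by simp
  have "closed {x :: 'm dbl. norm (snd x) \<le> norm (fst x)}"
    by (intro closed_Collect_le continuous_intros)
  moreover have "N \<subseteq> {x. norm (snd x) \<le> norm (fst x)}" using N by (auto simp: cone_O_def)
  ultimately have "closure N \<subseteq> {x. norm (snd x) \<le> norm (fst x)}" by (rule closure_minimal[rotated])
  then have "norm (snd x0) \<le> norm (fst x0)" using x0(1) by blast
  moreover have "norm (snd x0) \<noteq> norm (fst x0)"
  proof
    assume eq: "norm (snd x0) = norm (fst x0)"
    have "v (star x0) = v x0"
      by (rule rad[unfolded doubly_radial_def, rule_format]) (simp_all add: star_def eq)
    then show False using odd[of x0] pos by simp
  qed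
  ultimately have "x0 \<in> cone_O" by (simp add: cone_O_def)
  then have "x0 \<in> N" using nonpos[of x0] pos by force
  moreover have "v y \<le> v x0" if y: "y \<in> cone_O" for y
  proof (cases "y \<in> N")
    case True
    show ?thesis
    proof (cases "b \<le> norm y")
      case True
      then have "v y < v x1" using b \<open>y \<in> N\<close> by blast
      then show ?thesis using x0(2)[OF x1X] by simp
    next
      case False
      then show ?thesis using x0(2)[of y] \<open>y \<in> N\<close> closure_subset[of N] by auto
    qed
  next
    case False
    then show ?thesis using nonpos[of y] y pos by simp
  qed
  ultimately show ?thesis using that pos by blast
qed

section \<open>Almost everywhere bounds and the contradiction at a nearly maximal point\<close>

lemma AE_lebesgue_open_obtains:
  assumes "AE x in lebesgue. P x" "open U" "U \<noteq> {}"
  obtains x :: "'a::euclidean_space" where "x \<in> U" "P x"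
proof -
  have "\<exists>x\<in>U. P x"
  proof (rule ccontr)
    assume "\<not> (\<exists>x\<in>U. P x)"
    moreover obtain Z where "Z \<in> null_sets lebesgue" "{x. \<not> P x} \<subseteq> Z"
      using assms(1) by (auto simp: eventually_ae_filter)
    ultimately have "U \<subseteq> Z" "negligible Z"
      by (auto simp: negligible_iff_null_sets)
    then show False
      using open_not_negligible[OF assms(2,3)] negligible_subset by blast
  qed
  then show ?thesis using that by blast
qed

text \<open>Asking for a strict upper bound avoids showing that the infimum is attained. The
  pointwise bound \<open>B\<close> makes the set of essential bounds nonempty, so that its
  \<open>Inf\<close> is meaningful.\<close>

lemma Linf_norm_AE_less:
  assumes "Linf_norm S f < C" "0 \<le> B" "\<And>x. x \<in> S \<Longrightarrow> \<bar>f x\<bar> \<le> B"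
  shows "AE x in lebesgue. x \<in> S \<longrightarrow> \<bar>f x\<bar> < C"
proof -
  let ?A = "{B. 0 \<le> B \<and> (AE x in lebesgue. x \<in> S \<longrightarrow> \<bar>f x\<bar> \<le> B)}"
  have "B \<in> ?A" using assms(2,3) by (auto intro!: AE_I2)
  then obtain B' where "B' \<in> ?A" "B' < C"
    using cInf_lessD[of ?A C] assms(1) unfolding Linf_norm_def by blast
  then show ?thesis by (auto elim!: eventually_mono)
qed

text \<open>The lower bound on \<open>c\<close> is available only almost everywhere, so it may fail at the maximum
  point \<open>x0\<close> itself; hence the equation is used at a nearby point \<open>x\<close>, where \<open>v\<close> is
  only almost maximal, and all the estimates are uniform near \<open>x0\<close>.\<close>

lemma nonpos_in_narrow_domain:
  fixes N :: "('m::finite) dbl set" and K v c :: "'m dbl \<Rightarrow> real"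
  assumes \<gamma>: "0 < \<gamma>" "\<gamma> < 1" and lam: "0 < lam" "lam \<le> Lam" and \<epsilon>: "0 < \<epsilon>"
    and N: "open N" "N \<subseteq> {x. norm (snd x) < norm (fst x) \<and> norm (fst x) < norm (snd x) + \<epsilon>}"
    and \<mu>: "normalized_Haar_O2 \<mu>" and Krad: "radially_symmetric K" and pos: "positivity_condition \<mu> K"
    and K: "kernel_class_L0 \<gamma> lam Lam K"
    and \<alpha>: "2 * \<gamma> < \<alpha>" and cont: "continuous_on (closure N) v"
    and v: "v \<in> Holder_space \<alpha> N" "v \<in> L1_weighted \<gamma>" "doubly_radial v"
    and eq: "\<And>x. x \<in> N \<Longrightarrow> L_op K v x + c x * v x \<le> 0"
    and nonpos: "\<And>x. x \<in> cone_O - N \<Longrightarrow> v x \<le> 0" and odd: "\<And>x. - v (star x) = v x"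
    and lim: "Limsup (inf at_infinity (principal N)) (\<lambda>x. ereal (v x)) \<le> 0"
    and c: "AE x in lebesgue. x \<in> N \<longrightarrow> - c x < C" and C: "0 < C"
    and narrow: "C \<le> lam * c_const DIM('m dbl) \<gamma> * unit_ball_vol (real DIM('m dbl))
      * 4 powr - (real DIM('m dbl) + 2 * \<gamma>) * \<epsilon> powr - (2 * \<gamma>)"
    and x1: "x1 \<in> N"
  shows "v x1 \<le> 0"
proof (rule ccontr)
  assume "\<not> v x1 \<le> 0"
  then have "0 < v x1" by simp
  have NO: "N \<subseteq> cone_O" using N(2) by (auto simp: cone_O_def)
  obtain x0 where x0: "x0 \<in> N" "0 < v x0" and max: "\<And>y. y \<in> cone_O \<Longrightarrow> v y \<le> v x0"
    using positive_maximum_attained[OF NO cont v(3) nonpos odd lim x1 \<open>0 < v x1\<close>] by blast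
  define M where "M = v x0"
  have M: "0 < M" using x0(2) by (simp add: M_def)
  define n where "n = DIM('m dbl)"
  \<comment> \<open>With \<open>s\<close> at most 2 this makes \<open>q\<close> below nonnegative,
    as the integral bound over balls requires.\<close>
  have n: "2 \<le> n" unfolding n_def by (simp add: one_le_card_finite Suc_leI flip: mult_2)
  define s where "s = min \<alpha> 2"
  have s: "2 * \<gamma> < s" "s \<le> 2" using \<alpha> \<gamma> by (auto simp: s_def)
  have "0 < \<alpha>" using \<alpha> \<gamma> by simp
  then obtain r0 D0 where r0: "0 < r0" "ball x0 (2 * r0) \<subseteq> N"
    and D0: "\<And>y h. y \<in> ball x0 r0 \<Longrightarrow> norm h < r0 \<Longrightarrow> \<bar>v (y + h) + v (y - h) - 2 * v y\<bar> \<le> D0 * norm h powr s"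
    using Holder_space_second_difference[OF N(1) x0(1) v(1)] unfolding s_def by metis
  define D where "D = \<bar>D0\<bar>"
  have D: "0 \<le> D" "\<bar>v (y + h) + v (y - h) - 2 * v y\<bar> \<le> D * norm h powr s"
    if "y \<in> ball x0 r0" "norm h < r0" for y h
    using order_trans[OF D0[OF that] mult_right_mono[OF abs_ge_self]] by (simp_all add: D_def)
  have "0 \<le> D" by (simp add: D_def)
  define q where "q = real n + 2 * \<gamma> - s"
  have q: "0 \<le> q" "q < real n" using n \<gamma> s by (auto simp: q_def)
  obtain B where B: "0 \<le> B" "\<And>\<rho>. 0 < \<rho> \<Longrightarrow>
      (\<integral>\<^sup>+(z::'m dbl). ennreal (norm z powr - q) * indicator (cball 0 \<rho>) z \<partial>lborel) \<le> ennreal (B * \<rho> powr (s - 2 * \<gamma>))"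
    using nn_integral_norm_powr_cball[where 'a="'m dbl", of q] q unfolding n_def[symmetric]
    by (auto simp: q_def)
  define A where "A = Lam * c_const n \<gamma>"
  have "continuous (at x0) v"
    using cont N(1) x0(1) closure_subset[of N] by (metis continuous_on_subset continuous_on_eq_continuous_at)
  then have near: "\<exists>d>0. \<forall>y. dist y x0 < d \<longrightarrow> \<bar>v y - M\<bar> < e" if "0 < e" for e
    using that unfolding continuous_at_eps_delta dist_real_def M_def by blast
  obtain d where d: "0 < d" "\<And>y. dist y x0 < d \<Longrightarrow> \<bar>v y - M\<bar> < M / 4"
    using near[of "M / 4"] M by auto
  \<comment> \<open>Since \<open>s\<close> exceeds 2 \<gamma>, the inner error vanishes with \<rho>,
    however large \<open>A\<close>, and hence \<open>Lam\<close>, may be.\<close>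
  have "((\<lambda>\<rho>. D * A * (B * \<rho> powr (s - 2 * \<gamma>))) \<longlongrightarrow> D * A * (B * 0 powr (s - 2 * \<gamma>))) (at_right 0)"
    using s by (intro tendsto_intros) (auto intro: eventually_at_rightI[of 0 1])
  then have "\<forall>\<^sub>F \<rho> in at_right 0. D * A * (B * \<rho> powr (s - 2 * \<gamma>)) < C * M / 8"
    by (rule order_tendstoD(2)) (use C M in simp)
  then obtain \<rho>1 where \<rho>1: "0 < \<rho>1" "\<And>\<rho>. 0 < \<rho> \<Longrightarrow> \<rho> < \<rho>1 \<Longrightarrow> D * A * (B * \<rho> powr (s - 2 * \<gamma>)) < C * M / 8"
    unfolding eventually_at_right_field by auto
  \<comment> \<open>The half leaves room for the shift from \<open>x0\<close> to \<open>x\<close>: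
    \<open>cball x \<rho>\<close> stays in the regularity ball of \<open>x0\<close>, and tube
    representatives stay within \<open>d\<close> of \<open>x0\<close>.\<close>
  define \<rho> where "\<rho> = min \<rho>1 (min r0 d) / 2"
  have \<rho>: "0 < \<rho>" "\<rho> < \<rho>1" "\<rho> < r0" "2 * \<rho> \<le> d" using \<rho>1(1) r0(1) d(1) by (auto simp: \<rho>_def)
  have small: "D * A * (B * \<rho> powr (s - 2 * \<gamma>)) < C * M / 8" by (rule \<rho>1(2)) fact+
  define T where "T = (LINT z:{z. \<rho> < norm z}|lebesgue. K z)"
  \<comment> \<open>\<open>T\<close> is already fixed by \<rho>, so \<open>x\<close> can still be
    brought close enough to \<open>x0\<close> to make \<open>(M - v x) * T\<close> small; the added
    1 keeps the denominator positive.\<close>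
  obtain d' where d': "0 < d'" "\<And>y. dist y x0 < d' \<Longrightarrow> \<bar>v y - M\<bar> < C * M / (8 * (\<bar>T\<bar> + 1))"
    using near[of "C * M / (8 * (\<bar>T\<bar> + 1))"] M C by auto
  obtain x where x: "x \<in> ball x0 (min \<rho> d')" "x \<in> N \<longrightarrow> - c x < C"
  proof (rule AE_lebesgue_open_obtains[OF c open_ball])
    show "ball x0 (min \<rho> d') \<noteq> {}" using \<rho>(1) d'(1) by simp
  qed
  have xx0: "dist x x0 < \<rho>" "dist x x0 < d'" using x(1) by (auto simp: dist_commute)
  have sub: "cball x \<rho> \<subseteq> N"
  proof
    fix y assume "y \<in> cball x \<rho>"
    then have "dist x0 y < 2 * r0" using dist_triangle[of x0 y x] xx0(1) \<rho>(3) by (simp add: dist_commute)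
    then show "y \<in> N" using r0(2) by auto
  qed
  then have xN: "x \<in> N" using \<rho>(1) by auto
  define J where "J = (LINT y:{y. norm (fst y) < norm (snd y)}|lebesgue. K (x - y))"
  define I where "I = (LINT y:{y. \<rho> < norm (x - y)}|lebesgue. (v x - v y) * K (x - y))"
  have tube: "M - v y \<le> M / 4" if y: "y \<in> tube x \<rho>" for y
  proof -
    obtain z where z: "norm (fst z) = norm (fst y)" "norm (snd z) = norm (snd y)" "dist x z \<le> \<rho>"
      using tube_representative[OF _ y] \<rho>(1) by auto
    have "dist z x0 < d" using dist_triangle[of z x0 x] z(3) xx0(1) \<rho>(4) by (simp add: dist_commute)
    moreover have "v y = v z"
      by (rule v(3)[unfolded doubly_radial_def, rule_format]) (simp_all add: z)
    ultimately show ?thesis using d(2)[of z] by (simp add: abs_if split: if_splits)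
  qed
  have M0: "0 \<le> M" and maxM: "\<And>y. y \<in> cone_O \<Longrightarrow> v y \<le> M" using M max by (simp_all add: M_def)
  have vxM: "v x \<le> M" using maxM xN NO by blast
  note outer = K \<gamma> lam(1) \<mu> Krad pos v(2,3) odd \<rho>(1) subset_trans[OF sub NO] M0 maxM tube
  have J: "C \<le> J"
    using set_integral_reflected_cone_ge[OF K \<gamma> lam(1) \<epsilon> _ _ set_integrable_reflected_cone[OF outer]] N(2) xN narrow
    unfolding J_def by force
  have I: "(2 * M - M / 4) * J - (M - v x) * T \<le> I"
    using outer_integral_ge(2)[OF outer] unfolding J_def T_def I_def .
  obtain l where l: "((\<lambda>r. LINT y:{y. r < norm (x - y)}|lebesgue. (v x - v y) * K (x - y)) \<longlongrightarrow> l) (at_right 0)"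
    "I - D * A * (B * \<rho> powr (s - 2 * \<gamma>)) \<le> l"
  proof (rule L_op_tendsto[OF K \<gamma> lam v(2) s(1) _ \<rho>(1) \<open>0 \<le> D\<close>, of x "B * \<rho> powr (s - 2 * \<gamma>)"])
    show "s \<le> real DIM('m dbl) + 2 * \<gamma>" using q(1) by (simp add: q_def n_def)
    show "\<bar>v (x + h) + v (x - h) - 2 * v x\<bar> \<le> D * norm h powr s" if "norm h \<le> \<rho>" for h
      using that xx0(1) \<rho>(3) by (intro D(2)) (auto simp: dist_commute)
    show "0 \<le> B * \<rho> powr (s - 2 * \<gamma>)" using B(1) by simp
    show "(\<integral>\<^sup>+(z::'m dbl). ennreal (norm z powr - (real DIM('m dbl) + 2 * \<gamma> - s)) * indicator (cball 0 \<rho>) z \<partial>lborel)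
        \<le> ennreal (B * \<rho> powr (s - 2 * \<gamma>))"
      using B(2)[OF \<rho>(1)] unfolding q_def n_def .
  qed (use that in \<open>simp add: I_def A_def n_def\<close>)
  have "L_op K v x = l"
    unfolding L_op_def by (rule tendsto_Lim[OF _ l(1)]) simp
  then have "l \<le> - c x * v x" using eq[OF xN] by simp
  also have "\<dots> \<le> C * v x"
  proof -
    have "\<bar>v x - M\<bar> < M / 4" using d(2) xx0(1) \<rho>(1,4) by simp
    then have "0 \<le> v x" using M by (simp add: abs_if split: if_splits)
    then show ?thesis using x(2) xN by (intro mult_right_mono) auto
  qed
  also have "\<dots> \<le> C * M" using C vxM by (intro mult_left_mono) auto
  finally have up: "l \<le> C * M" .
  have "(M - v x) * T \<le> C * M / 8"
  proof -
    have le: "M - v x \<le> C * M / (8 * (\<bar>T\<bar> + 1))" "0 \<le> M - v x"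
      using d'(2)[OF xx0(2)] vxM by simp_all
    have "(M - v x) * T \<le> (M - v x) * (\<bar>T\<bar> + 1)" using le(2) by (intro mult_left_mono) auto
    also have "\<dots> \<le> C * M / (8 * (\<bar>T\<bar> + 1)) * (\<bar>T\<bar> + 1)" using le(1) by (intro mult_right_mono) auto
    also have "\<dots> = C * M / 8" by (simp add: field_simps)
    finally show ?thesis .
  qed
  moreover have "(2 * M - M / 4) * C \<le> (2 * M - M / 4) * J" using J M by (intro mult_left_mono) auto
  \<comment> \<open>The balance is 2 - 1/4 - 1/8 - 1/8 = 3/2: the losses come from the tube, the
    defect at \<open>x\<close> and the inner ball. It exceeds the factor 1 in the upper bound for
    \<open>l\<close>.\<close>
  ultimately have "(2 * M - M / 4) * C - C * M / 8 - C * M / 8 < l"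
    using I l(2) small by linarith
  then have "3 / 2 * (C * M) < C * M" using up by (simp add: algebra_simps)
  then show False using mult_pos_pos[OF C M] by simp
qed

text \<open>The quantifier order expresses the dependence of the threshold: it is chosen from
  \<gamma>, \<open>lam\<close>, \<open>C\<close> and the dimension, before \<open>Lam\<close>, the
  kernel, the domain and the functions.\<close>

theorem proposition6p1:
  fixes \<gamma> lam C :: real
  assumes "0 < \<gamma>" "\<gamma> < 1" "0 < lam"
  shows "\<exists>\<epsilon>bar>0. \<forall>(Lam::real) (\<epsilon>::real) (\<alpha>::real) (N :: ('m::finite) dbl set) (\<mu> :: 'm mat2 measure)
            (K :: 'm dbl \<Rightarrow> real) (v :: 'm dbl \<Rightarrow> real) (c :: 'm dbl \<Rightarrow> real).
     lam \<le> Lam \<longrightarrow>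
     0 < \<epsilon> \<longrightarrow>
     open N \<longrightarrow>
     N \<subseteq> {x. norm (snd x) < norm (fst x) \<and> norm (fst x) < norm (snd x) + \<epsilon>} \<longrightarrow>
     normalized_Haar_O2 \<mu> \<longrightarrow>
     radially_symmetric K \<longrightarrow>
     positivity_condition \<mu> K \<longrightarrow>
     kernel_class_L0 \<gamma> lam Lam K \<longrightarrow>
     \<alpha> > 2 * \<gamma> \<longrightarrow>
     continuous_on (closure N) v \<longrightarrow>
     v \<in> Holder_space \<alpha> N \<longrightarrow>
     v \<in> L1_weighted \<gamma> \<longrightarrow>
     doubly_radial v \<longrightarrow>
     (\<forall>x\<in>N. L_op K v x + c x * v x \<le> 0) \<longrightarrow>
     (\<forall>x\<in>cone_O - N. v x \<le> 0) \<longrightarrow>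
     (\<forall>x. - v (star x) = v x) \<longrightarrow>
     Limsup (inf at_infinity (principal N)) (\<lambda>x. ereal (v x)) \<le> 0 \<longrightarrow>
     (\<exists>B. \<forall>x\<in>N. B \<le> c x) \<longrightarrow>
     Linf_norm N (\<lambda>x. max 0 (- c x)) = C \<longrightarrow>
     \<epsilon> < \<epsilon>bar \<longrightarrow>
     (\<forall>x\<in>N. v x \<le> 0)"
proof -
  define n where "n = DIM('m dbl)"
  define \<kappa> where "\<kappa> = lam * c_const n \<gamma> * unit_ball_vol (real n) * 4 powr - (real n + 2 * \<gamma>)"
  \<comment> \<open>Strictly above the norm, for the almost everywhere bound, and positive even when
    \<open>C\<close> is 0, so that it can be divided by.\<close>
  define C1 where "C1 = \<bar>C\<bar> + 1"
  have C1: "0 < C1" "C < C1" by (auto simp: C1_def)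
  have "0 < n" unfolding n_def by (rule DIM_positive)
  then have \<kappa>: "0 < \<kappa>"
    using c_const_pos[OF assms(1,2), of n] assms(3) by (simp add: \<kappa>_def)
  \<comment> \<open>The solution of
    \<open>\<kappa> * \<epsilon> powr - (2 * \<gamma>) = C1\<close>.\<close>
  define \<epsilon>bar where "\<epsilon>bar = (\<kappa> / C1) powr (1 / (2 * \<gamma>))"
  have narrow: "C1 \<le> \<kappa> * \<epsilon> powr - (2 * \<gamma>)" if "0 < \<epsilon>" "\<epsilon> < \<epsilon>bar" for \<epsilon>
  proof -
    have "\<epsilon> powr (2 * \<gamma>) \<le> \<epsilon>bar powr (2 * \<gamma>)"
      using that assms(1) by (intro powr_mono2) auto
    also have "\<dots> = \<kappa> / C1"
      using assms(1) \<kappa> C1(1) by (simp add: \<epsilon>bar_def powr_powr)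
    finally show ?thesis using that C1(1) by (simp add: powr_minus field_simps)
  qed
  show ?thesis
  proof (intro exI[of _ \<epsilon>bar] conjI allI impI ballI)
    show "0 < \<epsilon>bar" using \<kappa> C1(1) by (simp add: \<epsilon>bar_def)
  next
    fix Lam \<epsilon> \<alpha> :: real and N :: "'m dbl set" and \<mu> :: "'m mat2 measure" and K v c :: "'m dbl \<Rightarrow> real"
      and x :: "'m dbl"
    assume A: "lam \<le> Lam" "0 < \<epsilon>" "open N"
      "N \<subseteq> {x. norm (snd x) < norm (fst x) \<and> norm (fst x) < norm (snd x) + \<epsilon>}"
      "normalized_Haar_O2 \<mu>" "radially_symmetric K" "positivity_condition \<mu> K" "kernel_class_L0 \<gamma> lam Lam K"
      "2 * \<gamma> < \<alpha>" "continuous_on (closure N) v" "v \<in> Holder_space \<alpha> N" "v \<in> L1_weighted \<gamma>" "doubly_radial v"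
      "\<forall>x\<in>N. L_op K v x + c x * v x \<le> 0" "\<forall>x\<in>cone_O - N. v x \<le> 0" "\<forall>x. - v (star x) = v x"
      "Limsup (inf at_infinity (principal N)) (\<lambda>x. ereal (v x)) \<le> 0"
      and bdd: "\<exists>B. \<forall>x\<in>N. B \<le> c x" and norm: "Linf_norm N (\<lambda>x. max 0 (- c x)) = C"
      and small: "\<epsilon> < \<epsilon>bar" and x: "x \<in> N"
    obtain B where B: "\<And>x. x \<in> N \<Longrightarrow> B \<le> c x" using bdd by blast
    have "\<bar>max 0 (- c x)\<bar> \<le> \<bar>B\<bar>" if "x \<in> N" for x using B[OF that] by (simp add: max_def)
    then have "AE x in lebesgue. x \<in> N \<longrightarrow> \<bar>max 0 (- c x)\<bar> < C1"
      using norm C1(2) by (intro Linf_norm_AE_less[where B="\<bar>B\<bar>"]) auto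
    then have "AE x in lebesgue. x \<in> N \<longrightarrow> - c x < C1" by (auto elim!: eventually_mono)
    then show "v x \<le> 0"
      using nonpos_in_narrow_domain[of \<gamma> lam Lam \<epsilon> N \<mu> K \<alpha> v c C1 x] A assms C1(1)
        narrow[OF A(2) small] x
      by (simp add: \<kappa>_def n_def)
  qed
qed

end
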